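(* Let $k$ be a field, let $V$ and $W$ be $k$-vector spaces, let $n\ge 0$ be an integer, and let $\phi: V^{\frac{n(n-1)}{2}}\to W$ be a $2$-alternating $k$-multilinear map. Then there exists a unique $k$-linear map $f:\Lambda^{S^2}_V(n+1)\to W$ such that $f\circ\alpha=\phi$, where $\alpha: V^{\frac{n(n-1)}{2}}\to \Lambda^{S^2}_V(n+1)$ is the natural map.
   Context: $k$ is a field, $\otimes=\otimes_k$, and $V^{\otimes 0}=k$. **Tensor spaces.** For $m\ge 1$ let $\mathcal T(m)=\mathcal T^{S^2}_V(m)=V^{\otimes \frac{(m-1)(m-2)}{2}}$, with tensor factors indexed by the pairs $(p,q)$ with $1\le p<q\le m-1$. A simple tensor $\otimes_{p<q}(u_{p,q})$ is written as an upper triangular $(m-1)\times(m-1)$ tensor matrix with diagonal entries $1$ and entries $u_{p,q}\in V$ above the diagonal. So $\mathcal T(1)$ and $\mathcal T(2)$ are one-dimensional. For $m,n\ge 1$ let $\mathcal B_V(m,n)=V^{\otimes (m-1)(n-1)}$, with factors indexed by positions in an $(m-1)\times(n-1)$ matrix; simple tensors are $\otimes_{r,s}(w_{r,s})$. Transposition of matrices gives a linear isomorphism $A\mapsto A^{tr}$, $\mathcal B_V(m,n)\to\mathcal B_V(n,m)$. **Operations.** For $m,n\ge1$ and $1\le i\le m$ there is a linear map $\diamond_i:\mathcal T(m)\otimes\mathcal B_V(m,n)\otimes\mathcal T(n)\to\mathcal T(m+n-1)$, defined on simple tensors $x=\otimes(u_{p,q})$, $A=\otimes(w_{r,s})$,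 $y=\otimes(v_{p,q})$ as follows (scalars are multiplied through when a space is $V^{\otimes 0}=k$). Among the indices $1,\dots,m+n-2$, call $i,\dots,i+n-2$ new and the others old; put $\sigma(p)=p$ for old $p<i$ and $\sigma(p)=p-(n-1)$ for old $p\ge i+n-1$. The result $\diamond_i(x,A,y)$ is the simple tensor whose entry in position $(p,q)$, $p<q$, is $u_{\sigma(p),\sigma(q)}$ if $p,q$ are both old; $v_{p-i+1,q-i+1}$ if both are new; and $w_{\sigma(o),\,t-i+1}$ if one of $p,q$ is old, equal to $o$, and the other is new, equal to $t$. **Ideals.** An ideal of $\mathcal T^{S^2}_V$ is a family of subspaces $\mathcal I(m)\subseteq\mathcal T(m)$, $m\ge1$, such that for all $m,n\geq 1$, $x\in\mathcal I(m)$, $y\in\mathcal T(n)$, $A\in\mathcal B_V(m,n)$ we have $\diamond_i(x,A,y)\in\mathcal I(m+n-1)$ for $1\le i\le m$ and $\diamond_i(y,A^{tr},x)\in\mathcal I(m+n-1)$ for $1\le i\le n$. The ideal generated by a set is the smallest ideal containing it. **The exterior GSC-operad.** $\mathcal E^{S^2}_V$ is the ideal generated by all elements $\otimes\begin{pmatrix}1&v&v\\&1&v\\&&1\end{pmatrix}\in\mathcal T(4)$, $v\in V$, and $\Lambda^{S^2}_V(m)=\mathcal T^{S^2}_V(m)/\mathcal E^{S^2}_V(m)$. **Maps.** Elements of $V^{\frac{n(n-1)}{2}}$ are families $(v_{i,j})_{1\le i<j\le n}$ of vectors of $V$. The natural map $\alpha:V^{\frac{n(n-1)}{2}}\to\Lambda^{S^2}_V(n+1)$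 sends $(v_{i,j})$ to the class of $\otimes_{i<j}(v_{i,j})\in\mathcal T^{S^2}_V(n+1)$. A $k$-multilinear map $\phi:V^{\frac{n(n-1)}{2}}\to W$ is $2$-alternating if $\phi((v_{i,j}))=0$ whenever there exist $1\le i<j<l\le n$ with $v_{i,j}=v_{i,l}=v_{j,l}$. *)

theory Defs
  imports "Jordan_Normal_Form.Missing_VectorSpace" "HOL-Algebra.QuotRing"
begin

section \<open>Quotient spaces\<close>

text \<open>The components \<^const>\<open>mult\<close> and \<^const>\<open>one\<close> of the record type of modules play no role
  for vector spaces. The multiplication by scalars is written as a union over representatives, like
  \<^const>\<open>rcoset_mult\<close>; one cannot take \<open>{c x | x \<in> C}\<close>, which is not a coset for \<open>c = 0\<close>.\<close>

definition quot_space ::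
  "('k, 'm) module \<Rightarrow> 'm set \<Rightarrow> ('k, 'm set) module"
  where "quot_space M N =
    \<lparr>carrier = a_rcosets\<^bsub>M\<^esub> N, mult = undefined, one = undefined, zero = N, add = set_add M,
     smult = (\<lambda>c C. \<Union>x\<in>C. N +>\<^bsub>M\<^esub> (c \<odot>\<^bsub>M\<^esub> x))\<rparr>"


section \<open>Tensor powers indexed by a finite set\<close>

definition free_space :: "'k ring \<Rightarrow> 'x set \<Rightarrow> ('k, 'x \<Rightarrow> 'k) module"
  where "free_space K X = (ring.func_space K X)
    \<lparr>carrier := {f \<in> X \<rightarrow>\<^sub>E carrier K. finite {x \<in> X. f x \<noteq> \<zero>\<^bsub>K\<^esub>}}\<rparr>"

definition free_gen :: "'k ring \<Rightarrow> 'x set \<Rightarrow> 'x \<Rightarrow> ('x \<Rightarrow> 'k)"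
  where "free_gen K X x = (\<lambda>y\<in>X. if y = x then \<one>\<^bsub>K\<^esub> else \<zero>\<^bsub>K\<^esub>)"

abbreviation families :: "('k, 'v) module \<Rightarrow> 'i set \<Rightarrow> ('i \<Rightarrow> 'v) set"
  where "families V S \<equiv> S \<rightarrow>\<^sub>E carrier V"

abbreviation free_fam :: "'k ring \<Rightarrow> ('k, 'v) module \<Rightarrow> 'i set \<Rightarrow> ('k, ('i \<Rightarrow> 'v) \<Rightarrow> 'k) module"
  where "free_fam K V S \<equiv> free_space K (families V S)"

abbreviation fam_gen :: "'k ring \<Rightarrow> ('k, 'v) module \<Rightarrow> 'i set \<Rightarrow> ('i \<Rightarrow> 'v) \<Rightarrow> (('i \<Rightarrow> 'v) \<Rightarrow> 'k)"
  where "fam_gen K V S u \<equiv> free_gen K (families V S) u"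

definition tensor_rels :: "'k ring \<Rightarrow> ('k, 'v) module \<Rightarrow> 'i set \<Rightarrow> (('i \<Rightarrow> 'v) \<Rightarrow> 'k) set"
  where "tensor_rels K V S =
    {fam_gen K V S (u(s := x \<oplus>\<^bsub>V\<^esub> y)) \<ominus>\<^bsub>free_fam K V S\<^esub>
       (fam_gen K V S (u(s := x)) \<oplus>\<^bsub>free_fam K V S\<^esub> fam_gen K V S (u(s := y))) | u s x y.
       u \<in> families V S \<and> s \<in> S \<and> x \<in> carrier V \<and> y \<in> carrier V} \<union>
    {fam_gen K V S (u(s := c \<odot>\<^bsub>V\<^esub> x)) \<ominus>\<^bsub>free_fam K V S\<^esub>
       (c \<odot>\<^bsub>free_fam K V S\<^esub> fam_gen K V S (u(s := x))) | u s c x.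
       u \<in> families V S \<and> s \<in> S \<and> c \<in> carrier K \<and> x \<in> carrier V}"

definition tensor_null :: "'k ring \<Rightarrow> ('k, 'v) module \<Rightarrow> 'i set \<Rightarrow> (('i \<Rightarrow> 'v) \<Rightarrow> 'k) set"
  where "tensor_null K V S = module.span K (free_fam K V S) (tensor_rels K V S)"

text \<open>\<open>tensor_space K V S\<close> is the tensor power of \<open>V\<close> with factors indexed by the finite set \<open>S\<close>.
  For \<open>S = {}\<close> there is one family and there are no relations, so that this is a copy of the field
  with basis the simple tensor of that family, which plays the role of the unit.\<close>

definition tensor_space ::
  "'k ring \<Rightarrow> ('k, 'v) module \<Rightarrow> 'i set \<Rightarrow> ('k, (('i \<Rightarrow> 'v) \<Rightarrow> 'k) set) module"
  where "tensor_space K V S = quot_space (free_fam K V S) (tensor_null K V S)"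

definition simple_tensor ::
  "'k ring \<Rightarrow> ('k, 'v) module \<Rightarrow> 'i set \<Rightarrow> ('i \<Rightarrow> 'v) \<Rightarrow> (('i \<Rightarrow> 'v) \<Rightarrow> 'k) set"
  where "simple_tensor K V S u = tensor_null K V S +>\<^bsub>free_fam K V S\<^esub> fam_gen K V S u"

definition multilinear ::
  "'k ring \<Rightarrow> ('k, 'v) module \<Rightarrow> 'i set \<Rightarrow> ('k, 'w) module \<Rightarrow> (('i \<Rightarrow> 'v) \<Rightarrow> 'w) \<Rightarrow> bool"
  where "multilinear K V S W \<phi> \<longleftrightarrow>
    \<phi> \<in> families V S \<rightarrow> carrier W \<and>
    (\<forall>u\<in>families V S. \<forall>s\<in>S. (\<lambda>x. \<phi> (u(s := x))) \<in> module_hom K V W)"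

text \<open>The linear map on the tensor power that takes the value \<open>\<phi> u\<close> on the simple tensor of \<open>u\<close>:
  evaluate the linear extension of \<open>\<phi>\<close> at a representative \<open>f\<close> of the class \<open>t\<close>. The value does
  not depend on \<open>f\<close> when \<open>\<phi>\<close> is multilinear.\<close>

definition tensor_lift ::
  "'k ring \<Rightarrow> ('k, 'v) module \<Rightarrow> 'i set \<Rightarrow> ('k, 'w) module \<Rightarrow> (('i \<Rightarrow> 'v) \<Rightarrow> 'w) \<Rightarrow>
    (('i \<Rightarrow> 'v) \<Rightarrow> 'k) set \<Rightarrow> 'w"
  where "tensor_lift K V S W \<phi> t =
    (THE w. \<exists>f\<in>t. w = (\<Oplus>\<^bsub>W\<^esub>u\<in>{u \<in> families V S. f u \<noteq> \<zero>\<^bsub>K\<^esub>}. f u \<odot>\<^bsub>W\<^esub> \<phi> u))"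


section \<open>The spaces \<open>\<T>(m)\<close> and \<open>\<B>(m,n)\<close> and the operations\<close>

type_synonym ('k, 'v) mtensor = "((nat \<times> nat \<Rightarrow> 'v) \<Rightarrow> 'k) set"

definition upper_pairs :: "nat \<Rightarrow> (nat \<times> nat) set"
  where "upper_pairs n = {(i, j). 1 \<le> i \<and> i < j \<and> j \<le> n}"

definition T_space :: "'k ring \<Rightarrow> ('k, 'v) module \<Rightarrow> nat \<Rightarrow> ('k, ('k, 'v) mtensor) module"
  where "T_space K V m = tensor_space K V (upper_pairs (m - 1))"

definition T_simple ::
  "'k ring \<Rightarrow> ('k, 'v) module \<Rightarrow> nat \<Rightarrow> (nat \<times> nat \<Rightarrow> 'v) \<Rightarrow> ('k, 'v) mtensor"
  where "T_simple K V m u = simple_tensor K V (upper_pairs (m - 1)) u"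

definition B_pairs :: "nat \<Rightarrow> nat \<Rightarrow> (nat \<times> nat) set"
  where "B_pairs m n = {1..m - 1} \<times> {1..n - 1}"

definition B_space :: "'k ring \<Rightarrow> ('k, 'v) module \<Rightarrow> nat \<Rightarrow> nat \<Rightarrow> ('k, ('k, 'v) mtensor) module"
  where "B_space K V m n = tensor_space K V (B_pairs m n)"

definition B_transpose ::
  "'k ring \<Rightarrow> ('k, 'v) module \<Rightarrow> nat \<Rightarrow> nat \<Rightarrow> ('k, 'v) mtensor \<Rightarrow> ('k, 'v) mtensor"
  where "B_transpose K V m n =
    tensor_lift K V (B_pairs m n) (B_space K V n m)
      (\<lambda>w. simple_tensor K V (B_pairs n m) (\<lambda>(r, s)\<in>B_pairs n m. w (s, r)))"

definition new_index :: "nat \<Rightarrow> nat \<Rightarrow> nat \<Rightarrow> bool"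
  where "new_index i n p \<longleftrightarrow> i \<le> p \<and> p < i + n - 1"

definition old_pos :: "nat \<Rightarrow> nat \<Rightarrow> nat \<Rightarrow> nat"
  where "old_pos i n p = (if p < i then p else p - (n - 1))"

definition diamond_entries ::
  "nat \<Rightarrow> nat \<Rightarrow> nat \<Rightarrow> (nat \<times> nat \<Rightarrow> 'v) \<Rightarrow> (nat \<times> nat \<Rightarrow> 'v) \<Rightarrow> (nat \<times> nat \<Rightarrow> 'v) \<Rightarrow>
    (nat \<times> nat \<Rightarrow> 'v)"
  where "diamond_entries m n i u w v =
    (\<lambda>(p, q)\<in>upper_pairs (m + n - 2).
      if \<not> new_index i n p \<and> \<not> new_index i n q then u (old_pos i n p, old_pos i n q)
      else if new_index i n p \<and> new_index i n q then v (p - i + 1, q - i + 1)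
      else if new_index i n q then w (old_pos i n p, q - i + 1)
      else w (old_pos i n q, p - i + 1))"

text \<open>A linear map on \<open>\<T>(m) \<otimes> \<B>(m,n) \<otimes> \<T>(n)\<close> is given as a map of three arguments that is linear
  in each of them, obtained by extending linearly from simple tensors in one argument after the
  other.\<close>

definition diamond ::
  "'k ring \<Rightarrow> ('k, 'v) module \<Rightarrow> nat \<Rightarrow> nat \<Rightarrow> nat \<Rightarrow>
    ('k, 'v) mtensor \<Rightarrow> ('k, 'v) mtensor \<Rightarrow> ('k, 'v) mtensor \<Rightarrow> ('k, 'v) mtensor"
  where "diamond K V m n i x A y =
    tensor_lift K V (upper_pairs (m - 1)) (T_space K V (m + n - 1)) (\<lambda>u.
      tensor_lift K V (B_pairs m n) (T_space K V (m + n - 1)) (\<lambda>w.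
        tensor_lift K V (upper_pairs (n - 1)) (T_space K V (m + n - 1)) (\<lambda>v.
          T_simple K V (m + n - 1) (diamond_entries m n i u w v)) y) A) x"


section \<open>Ideals and the exterior GSC-operad\<close>

text \<open>Families of subsets are indexed by all natural numbers; the member with index 0 is
  irrelevant.\<close>

definition T_ideal :: "'k ring \<Rightarrow> ('k, 'v) module \<Rightarrow> (nat \<Rightarrow> ('k, 'v) mtensor set) \<Rightarrow> bool"
  where "T_ideal K V I \<longleftrightarrow>
    (\<forall>m\<ge>1. subspace K (I m) (T_space K V m)) \<and>
    (\<forall>m\<ge>1. \<forall>n\<ge>1. \<forall>x\<in>I m. \<forall>y\<in>carrier (T_space K V n). \<forall>A\<in>carrier (B_space K V m n).
      (\<forall>i\<in>{1..m}. diamond K V m n i x A y \<in> I (m + n - 1)) \<and>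
      (\<forall>i\<in>{1..n}. diamond K V n m i y (B_transpose K V m n A) x \<in> I (m + n - 1)))"

definition T_ideal_generated ::
  "'k ring \<Rightarrow> ('k, 'v) module \<Rightarrow> (nat \<Rightarrow> ('k, 'v) mtensor set) \<Rightarrow> nat \<Rightarrow> ('k, 'v) mtensor set"
  where "T_ideal_generated K V G m =
    \<Inter>{I m | I. T_ideal K V I \<and> (\<forall>l\<ge>1. G l \<subseteq> I l)}"

definition E_generators :: "'k ring \<Rightarrow> ('k, 'v) module \<Rightarrow> nat \<Rightarrow> ('k, 'v) mtensor set"
  where "E_generators K V m =
    (if m = 4 then {T_simple K V 4 (\<lambda>_\<in>upper_pairs 3. v) | v. v \<in> carrier V} else {})"

definition E_ideal :: "'k ring \<Rightarrow> ('k, 'v) module \<Rightarrow> nat \<Rightarrow> ('k, 'v) mtensor set"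
  where "E_ideal K V = T_ideal_generated K V (E_generators K V)"

definition Lambda_space ::
  "'k ring \<Rightarrow> ('k, 'v) module \<Rightarrow> nat \<Rightarrow> ('k, ('k, 'v) mtensor set) module"
  where "Lambda_space K V m = quot_space (T_space K V m) (E_ideal K V m)"


section \<open>The natural map and 2-alternating maps\<close>

definition alpha ::
  "'k ring \<Rightarrow> ('k, 'v) module \<Rightarrow> nat \<Rightarrow> (nat \<times> nat \<Rightarrow> 'v) \<Rightarrow> ('k, 'v) mtensor set"
  where "alpha K V n v = E_ideal K V (n + 1) +>\<^bsub>T_space K V (n + 1)\<^esub> T_simple K V (n + 1) v"

definition two_alternating ::
  "('k, 'v) module \<Rightarrow> nat \<Rightarrow> ('k, 'w) module \<Rightarrow> ((nat \<times> nat \<Rightarrow> 'v) \<Rightarrow> 'w) \<Rightarrow> bool"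
  where "two_alternating V n W \<phi> \<longleftrightarrow>
    (\<forall>v\<in>families V (upper_pairs n).
      (\<exists>i j l. 1 \<le> i \<and> i < j \<and> j < l \<and> l \<le> n \<and> v (i, j) = v (i, l) \<and> v (i, l) = v (j, l))
      \<longrightarrow> \<phi> v = \<zero>\<^bsub>W\<^esub>)"

end

(* The spans J(m) of the simple tensors that have the same vector at the positions (i,j), (i,l), (j,l)
   of some triangle i < j < l form an ideal: the entries of x and of y reappear in a composite
   tensor matrix at positions given by an order preserving map of indices, so that triangles are
   carried to triangles. Hence J contains the exterior ideal. The linear map that a 2-alternating
   map induces on the tensor power vanishes on J, and so it factors through the quotient.
   Uniqueness holds because the classes of simple tensors span the quotient. *)

theory Submission
  imports Defs
begin

section \<open>Homomorphisms and quotients of modules\<close>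

text \<open>Elements of J are sums of simple tensors, and \<open>diamond\<close> is a nest of three
  definite descriptions; a level of that nest has a known value only if the map it lifts is
  multilinear. Most of the work goes into this. Its source is combinatorial: every entry of the
  three arguments occurs at exactly one position of the composite matrix, so that changing one entry
  of an argument changes one entry of the result, and the multilinearity of simple tensors carries
  over. \<open>tensor_lift_multilinear\<close> passes it through the inner levels, and
  \<open>diamond_in_submodule\<close> then reduces a claim about arbitrary arguments to one about
  matrices. The exterior ideal is an intersection of ideals, which says little about its elements
  directly. J bounds it from above, and this bound also shows that it lies in the tensor space at
  all. Linearity says nothing about values outside the carrier, so uniqueness is stated for
  extensional maps.\<close>

lemma module_homI:
  assumes "\<And>x. x \<in> carrier M \<Longrightarrow> f x \<in> carrier N"
    and "\<And>x y. \<lbrakk>x \<in> carrier M; y \<in> carrier M\<rbrakk> \<Longrightarrow> f (x \<oplus>\<^bsub>M\<^esub> y) = f x \<oplus>\<^bsub>N\<^esub> f y"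
    and "\<And>c x. \<lbrakk>c \<in> carrier R; x \<in> carrier M\<rbrakk> \<Longrightarrow> f (c \<odot>\<^bsub>M\<^esub> x) = c \<odot>\<^bsub>N\<^esub> f x"
  shows "f \<in> module_hom R M N"
  using assms by (auto simp: module_hom_def)

lemma mod_homI:
  assumes "module R M" and "module R N" and "f \<in> module_hom R M N"
  shows "mod_hom R M N f"
  using assms by (simp add: mod_hom_def mod_hom_axioms_def)

lemma module_hom_in:
  "\<lbrakk>f \<in> module_hom R M N; x \<in> carrier M\<rbrakk> \<Longrightarrow> f x \<in> carrier N"
  by (auto simp: module_hom_def)

lemma module_hom_comp:
  "\<lbrakk>f \<in> module_hom R L M; g \<in> module_hom R M N\<rbrakk> \<Longrightarrow> (\<lambda>x. g (f x)) \<in> module_hom R L N"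
  by (auto simp: module_hom_def Pi_iff)

lemma module_hom_plus:
  assumes "module R N" and f: "f \<in> module_hom R M N" and g: "g \<in> module_hom R M N"
    and "module R M"
  shows "(\<lambda>x. f x \<oplus>\<^bsub>N\<^esub> g x) \<in> module_hom R M N"
proof -
  interpret N: module R N by fact
  show ?thesis
    using module_hom_in[OF f] module_hom_in[OF g]
    by (intro module_homI)
      (simp_all add: module_hom_add[OF f] module_hom_add[OF g] module_hom_smult[OF f]
        module_hom_smult[OF g] N.smult_r_distr N.M.add.m_ac)
qed

lemma module_hom_scale:
  assumes "module R N" and f: "f \<in> module_hom R M N" and c: "c \<in> carrier R"
  shows "(\<lambda>x. c \<odot>\<^bsub>N\<^esub> f x) \<in> module_hom R M N"
proof -
  interpret N: module R N by fact
  have "c \<odot>\<^bsub>N\<^esub> (d \<odot>\<^bsub>N\<^esub> f x) = d \<odot>\<^bsub>N\<^esub> (c \<odot>\<^bsub>N\<^esub> f x)" if "d \<in> carrier R" "x \<in> carrier M" for d x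
    using that c module_hom_in[OF f] by (simp flip: N.smult_assoc1 add: N.R.m_comm)
  then show ?thesis
    using module_hom_in[OF f] c
    by (intro module_homI)
      (simp_all add: module_hom_add[OF f] module_hom_smult[OF f] N.smult_r_distr)
qed

text \<open>The standard way here to carry a span into a submodule: the preimage is a submodule, so
  it contains the span once it contains the generators. With \<open>N\<close> the zero submodule the
  preimage is the kernel.\<close>

lemma submodule_vimage:
  assumes "module R M" and "module R W" and h: "h \<in> module_hom R M W" and N: "submodule R N W"
  shows "submodule R {x \<in> carrier M. h x \<in> N} M"
proof -
  interpret M: module R M by fact
  interpret mod_hom R M W h by (rule mod_homI) fact+
  interpret N: submodule R N W by fact
  show ?thesis
    by unfold_locales auto
qed

lemma submodule_zero:
  assumes "module R M"
  shows "submodule R {\<zero>\<^bsub>M\<^esub>} M"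
proof -
  interpret M: module R M by fact
  show ?thesis by unfold_locales auto
qed

text \<open>The set on which two homomorphisms agree is a submodule, so it contains the span of
  \<open>S\<close> once it contains \<open>S\<close>.\<close>

lemma module_hom_eq_on_span:
  assumes "module R M" and "module R W" and "f \<in> module_hom R M W" and "g \<in> module_hom R M W"
    and "S \<subseteq> carrier M" and "\<And>s. s \<in> S \<Longrightarrow> f s = g s" and "x \<in> module.span R M S"
  shows "f x = g x"
proof -
  interpret M: module R M by fact
  interpret f: mod_hom R M W f by (rule mod_homI) fact+
  interpret g: mod_hom R M W g by (rule mod_homI) fact+
  have "submodule R {x \<in> carrier M. f x = g x} M"
    by unfold_locales auto
  then have "module.span R M S \<subseteq> {x \<in> carrier M. f x = g x}"
    using assms by (intro M.span_is_subset) auto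
  then show ?thesis
    using assms by auto
qed

section \<open>Quotients of a module by a submodule\<close>

locale quotient_module = module R M for R :: "'k ring" and M :: "('k, 'm) module" +
  fixes N :: "'m set"
  assumes submod: "submodule R N M"
begin

sublocale N: submodule R N M
  by (rule submod)

text \<open>This makes the coset calculus of additive groups available. Closure under negatives
  comes from scaling by -1.\<close>

sublocale N: abelian_subgroup N M
proof (rule abelian_subgroupI3)
  have neg: "\<ominus>\<^bsub>M\<^esub> x \<in> N" if "x \<in> N" for x
    using N.smult_closed[OF R.add.inv_closed[OF R.one_closed] that] subsetD[OF N.subset that]
    by (simp only: smult_minus_1 flip: a_inv_def)
  have "subgroup N (add_monoid M)"
  proof (rule M.add.subgroupI)
    show "N \<noteq> {}" using N.zero_closed by blast
  qed (use N.subset neg in \<open>simp_all add: a_inv_def\<close>)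
  then show "additive_subgroup N M"
    by (rule additive_subgroupI)
qed (rule M.abelian_group_axioms)

abbreviation Q :: "('k, 'm set) module"
  where "Q \<equiv> quot_space M N"

lemma carrier_quot: "carrier Q = (\<lambda>x. N +>\<^bsub>M\<^esub> x) ` carrier M"
  by (simp add: quot_space_def A_RCOSETS_def' UNION_singleton_eq_range)

lemma coset_in_quot [intro, simp]: "x \<in> carrier M \<Longrightarrow> N +>\<^bsub>M\<^esub> x \<in> carrier Q"
  unfolding carrier_quot by (rule imageI)

lemma add_quot [simp]:
  "\<lbrakk>x \<in> carrier M; y \<in> carrier M\<rbrakk> \<Longrightarrow> (N +>\<^bsub>M\<^esub> x) \<oplus>\<^bsub>Q\<^esub> (N +>\<^bsub>M\<^esub> y) = N +>\<^bsub>M\<^esub> (x \<oplus>\<^bsub>M\<^esub> y)"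
  by (simp add: quot_space_def N.a_rcos_sum)

lemma coset_eq_iff:
  assumes "x \<in> carrier M" "y \<in> carrier M"
  shows "N +>\<^bsub>M\<^esub> x = N +>\<^bsub>M\<^esub> y \<longleftrightarrow> x \<ominus>\<^bsub>M\<^esub> y \<in> N"
proof -
  have "N +>\<^bsub>M\<^esub> x = N +>\<^bsub>M\<^esub> y \<longleftrightarrow> x \<in> N +>\<^bsub>M\<^esub> y"
    using N.a_repr_independence'[of x y] N.a_repr_independenceD[of x y] assms by auto
  then show ?thesis
    using N.a_rcos_module[of y x] assms by (simp add: a_minus_def)
qed

text \<open>Two representatives x and y give the same coset, because c y - c x = c (y - x) lies in
  \<open>N\<close>. The union in the definition therefore runs over copies of one set, and it equals
  that set because a coset is nonempty.\<close>

lemma smult_quot [simp]: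
  assumes "c \<in> carrier R" "x \<in> carrier M"
  shows "c \<odot>\<^bsub>Q\<^esub> (N +>\<^bsub>M\<^esub> x) = N +>\<^bsub>M\<^esub> (c \<odot>\<^bsub>M\<^esub> x)"
proof -
  have "N +>\<^bsub>M\<^esub> (c \<odot>\<^bsub>M\<^esub> y) = N +>\<^bsub>M\<^esub> (c \<odot>\<^bsub>M\<^esub> x)" if "y \<in> N +>\<^bsub>M\<^esub> x" for y
  proof -
    have y: "y \<in> carrier M"
      using that assms N.a_elemrcos_carrier by blast
    have "y \<ominus>\<^bsub>M\<^esub> x \<in> N"
      using that y assms N.a_rcos_module[of x y] by (simp add: a_minus_def)
    moreover have "c \<odot>\<^bsub>M\<^esub> y \<ominus>\<^bsub>M\<^esub> c \<odot>\<^bsub>M\<^esub> x = c \<odot>\<^bsub>M\<^esub> (y \<ominus>\<^bsub>M\<^esub> x)"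
      using y assms by (simp add: a_minus_def smult_r_distr smult_r_minus)
    ultimately show ?thesis
      using y assms by (simp add: coset_eq_iff)
  qed
  then have "(\<Union>y\<in>N +>\<^bsub>M\<^esub> x. N +>\<^bsub>M\<^esub> (c \<odot>\<^bsub>M\<^esub> y)) = (\<Union>y\<in>N +>\<^bsub>M\<^esub> x. N +>\<^bsub>M\<^esub> (c \<odot>\<^bsub>M\<^esub> x))"
    by (rule SUP_cong[OF refl])
  moreover have "N +>\<^bsub>M\<^esub> x \<noteq> {}"
    using N.a_rcos_self[OF assms(2)] by blast
  ultimately show ?thesis
    unfolding quot_space_def by (simp only: module.simps UN_constant if_False)
qed

text \<open>By definition the zero is \<open>N\<close> itself; written as the coset of 0 it falls
  under the rules for sums and multiples of cosets.\<close>

lemma zero_quot: "\<zero>\<^bsub>Q\<^esub> = N +>\<^bsub>M\<^esub> \<zero>\<^bsub>M\<^esub>"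
  using N.subset by (simp add: quot_space_def)

lemma quot_cases:
  assumes "C \<in> carrier Q"
  obtains x where "x \<in> carrier M" and "C = N +>\<^bsub>M\<^esub> x"
  using assms by (auto simp: carrier_quot)

lemma module_quot: "module R Q"
proof (rule module.intro)
  show "cring R" by (rule R.is_cring)
  show "abelian_group Q"
  proof (rule abelian_groupI)
    show "\<zero>\<^bsub>Q\<^esub> \<in> carrier Q"
      unfolding zero_quot by (rule coset_in_quot) simp
  next
    fix C D assume "C \<in> carrier Q" "D \<in> carrier Q"
    then show "C \<oplus>\<^bsub>Q\<^esub> D \<in> carrier Q" and "C \<oplus>\<^bsub>Q\<^esub> D = D \<oplus>\<^bsub>Q\<^esub> C"
      by (elim quot_cases, simp add: M.a_comm)+
  next
    fix C D E assume "C \<in> carrier Q" "D \<in> carrier Q" "E \<in> carrier Q"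
    then show "(C \<oplus>\<^bsub>Q\<^esub> D) \<oplus>\<^bsub>Q\<^esub> E = C \<oplus>\<^bsub>Q\<^esub> (D \<oplus>\<^bsub>Q\<^esub> E)"
      by (elim quot_cases) (simp add: M.a_assoc)
  next
    fix C assume "C \<in> carrier Q"
    then obtain x where x: "x \<in> carrier M" "C = N +>\<^bsub>M\<^esub> x" by (rule quot_cases)
    then show "\<zero>\<^bsub>Q\<^esub> \<oplus>\<^bsub>Q\<^esub> C = C"
      unfolding zero_quot by (simp del: M.a_coset_add_zero)
    show "\<exists>D\<in>carrier Q. D \<oplus>\<^bsub>Q\<^esub> C = \<zero>\<^bsub>Q\<^esub>"
      unfolding zero_quot using x
      by (intro bexI[of _ "N +>\<^bsub>M\<^esub> (\<ominus>\<^bsub>M\<^esub> x)"]) (simp_all add: M.l_neg)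
  qed
  show "module_axioms R Q"
  proof (rule module_axioms.intro)
    fix a C assume a: "a \<in> carrier R" and "C \<in> carrier Q"
    then show "a \<odot>\<^bsub>Q\<^esub> C \<in> carrier Q" by (elim quot_cases) simp
  next
    fix C assume "C \<in> carrier Q"
    then show "\<one>\<^bsub>R\<^esub> \<odot>\<^bsub>Q\<^esub> C = C" by (elim quot_cases) simp
  next
    fix a b C assume ab: "a \<in> carrier R" "b \<in> carrier R" and "C \<in> carrier Q"
    then show "(a \<oplus>\<^bsub>R\<^esub> b) \<odot>\<^bsub>Q\<^esub> C = a \<odot>\<^bsub>Q\<^esub> C \<oplus>\<^bsub>Q\<^esub> b \<odot>\<^bsub>Q\<^esub> C"
      and "(a \<otimes>\<^bsub>R\<^esub> b) \<odot>\<^bsub>Q\<^esub> C = a \<odot>\<^bsub>Q\<^esub> (b \<odot>\<^bsub>Q\<^esub> C)"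
      by (elim quot_cases, simp add: smult_l_distr smult_assoc1)+
  next
    fix a C D assume "a \<in> carrier R" "C \<in> carrier Q" "D \<in> carrier Q"
    then show "a \<odot>\<^bsub>Q\<^esub> (C \<oplus>\<^bsub>Q\<^esub> D) = a \<odot>\<^bsub>Q\<^esub> C \<oplus>\<^bsub>Q\<^esub> a \<odot>\<^bsub>Q\<^esub> D"
      by (elim quot_cases) (simp add: smult_r_distr)
  qed
qed

lemma coset_hom: "(\<lambda>x. N +>\<^bsub>M\<^esub> x) \<in> module_hom R M Q"
  by (rule module_homI) auto

lemma hom_factors:
  assumes "module R W" and h: "h \<in> module_hom R M W" and ker: "\<And>x. x \<in> N \<Longrightarrow> h x = \<zero>\<^bsub>W\<^esub>"
  obtains f where "f \<in> extensional (carrier Q)" and "f \<in> module_hom R Q W"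
    and "\<And>x. x \<in> carrier M \<Longrightarrow> f (N +>\<^bsub>M\<^esub> x) = h x"
proof -
  interpret h: mod_hom R M W h
    using assms module_axioms by (intro mod_homI) auto
  \<comment> \<open>\<open>h\<close> is constant on each coset, so the image is a singleton. The
    restriction fixes the values outside the carrier, as the uniqueness claim of the theorem
    requires.\<close>
  define f where "f = restrict (\<lambda>C. the_elem (h ` C)) (carrier Q)"
  have f: "f (N +>\<^bsub>M\<^esub> x) = h x" if x: "x \<in> carrier M" for x
  proof -
    have "h y = h x" if y: "y \<in> N +>\<^bsub>M\<^esub> x" for y
    proof -
      have y': "y \<in> carrier M"
        using x y N.a_elemrcos_carrier by blast
      then have "h (y \<ominus>\<^bsub>M\<^esub> x) = \<zero>\<^bsub>W\<^esub>"
        using x y N.a_rcos_module[of x y] by (intro ker) (simp add: a_minus_def)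
      moreover have "(y \<ominus>\<^bsub>M\<^esub> x) \<oplus>\<^bsub>M\<^esub> x = y"
        using x y' by (simp add: a_minus_def M.a_assoc M.l_neg)
      moreover have "h ((y \<ominus>\<^bsub>M\<^esub> x) \<oplus>\<^bsub>M\<^esub> x) = h (y \<ominus>\<^bsub>M\<^esub> x) \<oplus>\<^bsub>W\<^esub> h x"
        using x y' by (intro h.f_add) simp_all
      ultimately show ?thesis
        using x by simp
    qed
    moreover have "x \<in> N +>\<^bsub>M\<^esub> x"
      using x N.a_rcos_self by blast
    ultimately have "h ` (N +>\<^bsub>M\<^esub> x) = {h x}" by blast
    then show ?thesis
      using x by (simp add: f_def)
  qed
  show ?thesis
  proof (rule that)
    show "f \<in> extensional (carrier Q)" by (simp add: f_def)
    show "f \<in> module_hom R Q W"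
      by (rule module_homI; elim quot_cases; simp add: f)
  qed (rule f)
qed

end


section \<open>Free modules\<close>

text \<open>This is the sum inside \<open>tensor_lift\<close>, for an arbitrary basis set. It runs
  over the support because the basis, there the set of all families of vectors, is infinite in
  general.\<close>

definition linear_ext ::
  "'k ring \<Rightarrow> 'x set \<Rightarrow> ('k, 'w) module \<Rightarrow> ('x \<Rightarrow> 'w) \<Rightarrow> ('x \<Rightarrow> 'k) \<Rightarrow> 'w"
  where "linear_ext K X W \<phi> f = (\<Oplus>\<^bsub>W\<^esub>x\<in>{x \<in> X. f x \<noteq> \<zero>\<^bsub>K\<^esub>}. f x \<odot>\<^bsub>W\<^esub> \<phi> x)"

locale scalar_ring = R: cring K for K :: "'k ring"
begin

lemma carrier_free: "carrier (free_space K X) = {f \<in> X \<rightarrow>\<^sub>E carrier K. finite {x \<in> X. f x \<noteq> \<zero>\<^bsub>K\<^esub>}}"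
  by (simp add: free_space_def)

lemma add_free: "f \<oplus>\<^bsub>free_space K X\<^esub> g = (\<lambda>x\<in>X. f x \<oplus>\<^bsub>K\<^esub> g x)"
  by (simp add: free_space_def R.func_space_def)

lemma smult_free: "c \<odot>\<^bsub>free_space K X\<^esub> f = (\<lambda>x\<in>X. c \<otimes>\<^bsub>K\<^esub> f x)"
  by (simp add: free_space_def R.func_space_def)

lemma zero_free: "\<zero>\<^bsub>free_space K X\<^esub> = (\<lambda>x\<in>X. \<zero>\<^bsub>K\<^esub>)"
  by (simp add: free_space_def R.func_space_def)

text \<open>The finitely supported functions form a submodule of all functions: the support of a sum
  lies in the union of the supports, and scaling does not enlarge a support.\<close>

lemma module_free: "module K (free_space K X)"
proof -
  interpret F: module K "R.func_space X" by (rule R.func_space_is_module)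
  have "submodule K {f \<in> X \<rightarrow>\<^sub>E carrier K. finite {x \<in> X. f x \<noteq> \<zero>\<^bsub>K\<^esub>}} (R.func_space X)"
  proof unfold_locales
    fix f g
    assume f: "f \<in> {f \<in> X \<rightarrow>\<^sub>E carrier K. finite {x \<in> X. f x \<noteq> \<zero>\<^bsub>K\<^esub>}}"
      and g: "g \<in> {f \<in> X \<rightarrow>\<^sub>E carrier K. finite {x \<in> X. f x \<noteq> \<zero>\<^bsub>K\<^esub>}}"
    have "{x \<in> X. f x \<oplus>\<^bsub>K\<^esub> g x \<noteq> \<zero>\<^bsub>K\<^esub>} \<subseteq> {x \<in> X. f x \<noteq> \<zero>\<^bsub>K\<^esub>} \<union> {x \<in> X. g x \<noteq> \<zero>\<^bsub>K\<^esub>}"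
      by auto
    then have "finite {x \<in> X. f x \<oplus>\<^bsub>K\<^esub> g x \<noteq> \<zero>\<^bsub>K\<^esub>}"
      using f g by (auto intro: finite_subset)
    then show "f \<oplus>\<^bsub>R.func_space X\<^esub> g \<in> {f \<in> X \<rightarrow>\<^sub>E carrier K. finite {x \<in> X. f x \<noteq> \<zero>\<^bsub>K\<^esub>}}"
      using f g by (auto simp: R.func_space_def PiE_iff cong: conj_cong)
  next
    fix c f
    assume c: "c \<in> carrier K"
      and f: "f \<in> {f \<in> X \<rightarrow>\<^sub>E carrier K. finite {x \<in> X. f x \<noteq> \<zero>\<^bsub>K\<^esub>}}"
    have "{x \<in> X. c \<otimes>\<^bsub>K\<^esub> f x \<noteq> \<zero>\<^bsub>K\<^esub>} \<subseteq> {x \<in> X. f x \<noteq> \<zero>\<^bsub>K\<^esub>}"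
      using c by auto
    then have "finite {x \<in> X. c \<otimes>\<^bsub>K\<^esub> f x \<noteq> \<zero>\<^bsub>K\<^esub>}"
      using f by (auto intro: finite_subset)
    then show "c \<odot>\<^bsub>R.func_space X\<^esub> f \<in> {f \<in> X \<rightarrow>\<^sub>E carrier K. finite {x \<in> X. f x \<noteq> \<zero>\<^bsub>K\<^esub>}}"
      using c f by (auto simp: R.func_space_def PiE_iff cong: conj_cong)
  qed (auto simp: R.func_space_def cong: conj_cong)
  then show ?thesis
    unfolding free_space_def by (rule F.submodule_is_module)
qed

lemma free_gen_closed [intro, simp]: "x \<in> X \<Longrightarrow> free_gen K X x \<in> carrier (free_space K X)"
  using finite_subset[of "{y \<in> X. free_gen K X x y \<noteq> \<zero>\<^bsub>K\<^esub>}" "{x}"]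
  by (force simp: carrier_free free_gen_def)

lemma free_space_generated: "module.span K (free_space K X) (free_gen K X ` X) = carrier (free_space K X)"
proof -
  interpret F: module K "free_space K X" by (rule module_free)
  let ?N = "module.span K (free_space K X) (free_gen K X ` X)"
  have sub: "submodule K ?N (free_space K X)"
    by (rule F.span_is_submodule) auto
  then interpret N: submodule K ?N "free_space K X" .
  have gen: "free_gen K X x \<in> ?N" if "x \<in> X" for x
    using that F.in_own_span[of "free_gen K X ` X"] by auto
  \<comment> \<open>The induction is on a finite set containing the support instead of the support
    itself, so that the step need not ask whether \<open>f a\<close> is zero.\<close>
  have "f \<in> ?N" if "finite A" "A \<subseteq> X" "f \<in> X \<rightarrow>\<^sub>E carrier K" "{x \<in> X. f x \<noteq> \<zero>\<^bsub>K\<^esub>} \<subseteq> A" for A f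
    using that
  proof (induction A arbitrary: f)
    case empty
    then have "f = \<zero>\<^bsub>free_space K X\<^esub>"
      by (auto simp: zero_free PiE_iff extensional_def fun_eq_iff)
    then show ?case by simp
  next
    case (insert a A)
    define g where "g = f(a := \<zero>\<^bsub>K\<^esub>)"
    have "g \<in> ?N"
      using insert.prems insert.hyps
      by (intro insert.IH) (auto simp: g_def PiE_iff extensional_def)
    moreover have "free_gen K X a \<in> ?N" and "f a \<in> carrier K"
      using insert.prems gen by auto
    moreover have "f = f a \<odot>\<^bsub>free_space K X\<^esub> free_gen K X a \<oplus>\<^bsub>free_space K X\<^esub> g"
    proof
      fix x
      show "f x = (f a \<odot>\<^bsub>free_space K X\<^esub> free_gen K X a \<oplus>\<^bsub>free_space K X\<^esub> g) x"
        using insert.prems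
        by (cases "x \<in> X")
          (auto simp: add_free smult_free free_gen_def g_def PiE_iff extensional_def)
    qed
    ultimately show ?case
      using N.m_closed N.smult_closed by metis
  qed
  then have "carrier (free_space K X) \<subseteq> ?N"
    by (auto simp: carrier_free)
  then show ?thesis
    using N.subset by auto
qed

text \<open>Two functions have different supports, and cancellation may shrink the support of their
  sum. A common finite superset makes the three sums comparable.\<close>

lemma linear_ext_eq:
  assumes "module K W" and \<phi>: "\<phi> \<in> X \<rightarrow> carrier W" and f: "f \<in> X \<rightarrow> carrier K"
    and A: "finite A" "A \<subseteq> X" "{x \<in> X. f x \<noteq> \<zero>\<^bsub>K\<^esub>} \<subseteq> A"
  shows "linear_ext K X W \<phi> f = (\<Oplus>\<^bsub>W\<^esub>x\<in>A. f x \<odot>\<^bsub>W\<^esub> \<phi> x)"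
proof -
  interpret W: module K W by fact
  have "\<phi> x \<in> carrier W" "f x \<in> carrier K" if "x \<in> X" for x
    using that \<phi> f by auto
  then show ?thesis
    unfolding linear_ext_def using A
    by (intro W.M.add.finprod_mono_neutral_cong_left) auto
qed

lemma linear_ext_hom:
  assumes "module K W" and \<phi>: "\<phi> \<in> X \<rightarrow> carrier W"
  shows "linear_ext K X W \<phi> \<in> module_hom K (free_space K X) W"
proof -
  interpret W: module K W by fact
  have W[simp]: "\<phi> x \<in> carrier W" if "x \<in> X" for x
    using that \<phi> by auto
  let ?s = "\<lambda>f. {x \<in> X. f x \<noteq> \<zero>\<^bsub>K\<^esub>}"
  note eq = linear_ext_eq[OF assms]
  show ?thesis
  proof (rule module_homI)
    fix f assume "f \<in> carrier (free_space K X)"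
    then show "linear_ext K X W \<phi> f \<in> carrier W"
      by (auto simp: linear_ext_def carrier_free PiE_iff intro!: W.M.finsum_closed)
  next
    fix f g assume fg: "f \<in> carrier (free_space K X)" "g \<in> carrier (free_space K X)"
    define A where "A = ?s f \<union> ?s g"
    have A: "finite A" "A \<subseteq> X" and AX: "\<And>x. x \<in> A \<Longrightarrow> x \<in> X"
      using fg by (auto simp: A_def carrier_free)
    have [simp]: "f x \<in> carrier K" "g x \<in> carrier K" if "x \<in> X" for x
      using fg that by (auto simp: carrier_free)
    have "linear_ext K X W \<phi> (f \<oplus>\<^bsub>free_space K X\<^esub> g) =
        (\<Oplus>\<^bsub>W\<^esub>x\<in>A. (f \<oplus>\<^bsub>free_space K X\<^esub> g) x \<odot>\<^bsub>W\<^esub> \<phi> x)"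
      using A by (intro eq) (auto simp: add_free A_def)
    also have "\<dots> = (\<Oplus>\<^bsub>W\<^esub>x\<in>A. f x \<odot>\<^bsub>W\<^esub> \<phi> x \<oplus>\<^bsub>W\<^esub> g x \<odot>\<^bsub>W\<^esub> \<phi> x)"
      using AX by (intro W.M.finsum_cong') (auto simp: add_free W.smult_l_distr)
    also have "\<dots> = (\<Oplus>\<^bsub>W\<^esub>x\<in>A. f x \<odot>\<^bsub>W\<^esub> \<phi> x) \<oplus>\<^bsub>W\<^esub> (\<Oplus>\<^bsub>W\<^esub>x\<in>A. g x \<odot>\<^bsub>W\<^esub> \<phi> x)"
      using AX by (intro W.M.finsum_addf) auto
    also have "(\<Oplus>\<^bsub>W\<^esub>x\<in>A. f x \<odot>\<^bsub>W\<^esub> \<phi> x) = linear_ext K X W \<phi> f"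
      using A by (intro eq[symmetric]) (auto simp: A_def)
    also have "(\<Oplus>\<^bsub>W\<^esub>x\<in>A. g x \<odot>\<^bsub>W\<^esub> \<phi> x) = linear_ext K X W \<phi> g"
      using A by (intro eq[symmetric]) (auto simp: A_def)
    finally show "linear_ext K X W \<phi> (f \<oplus>\<^bsub>free_space K X\<^esub> g) =
        linear_ext K X W \<phi> f \<oplus>\<^bsub>W\<^esub> linear_ext K X W \<phi> g" .
  next
    fix c f assume c: "c \<in> carrier K" and f: "f \<in> carrier (free_space K X)"
    have A: "finite (?s f)"
      using f by (auto simp: carrier_free)
    have [simp]: "f x \<in> carrier K" if "x \<in> X" for x
      using f that by (auto simp: carrier_free)
    have "linear_ext K X W \<phi> (c \<odot>\<^bsub>free_space K X\<^esub> f) =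
        (\<Oplus>\<^bsub>W\<^esub>x\<in>?s f. (c \<odot>\<^bsub>free_space K X\<^esub> f) x \<odot>\<^bsub>W\<^esub> \<phi> x)"
      using A c by (intro eq) (auto simp: smult_free)
    also have "\<dots> = (\<Oplus>\<^bsub>W\<^esub>x\<in>?s f. c \<odot>\<^bsub>W\<^esub> (f x \<odot>\<^bsub>W\<^esub> \<phi> x))"
      using c by (intro W.M.finsum_cong') (auto simp: smult_free W.smult_assoc1)
    also have "\<dots> = c \<odot>\<^bsub>W\<^esub> linear_ext K X W \<phi> f"
      unfolding linear_ext_def using A c by (intro W.finsum_smult_ldistr[symmetric]) auto
    finally show "linear_ext K X W \<phi> (c \<odot>\<^bsub>free_space K X\<^esub> f) = c \<odot>\<^bsub>W\<^esub> linear_ext K X W \<phi> f" .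
  qed
qed

lemma linear_ext_gen:
  assumes "module K W" and \<phi>: "\<phi> \<in> X \<rightarrow> carrier W" and x: "x \<in> X"
  shows "linear_ext K X W \<phi> (free_gen K X x) = \<phi> x"
proof -
  interpret W: module K W by fact
  have "linear_ext K X W \<phi> (free_gen K X x) = (\<Oplus>\<^bsub>W\<^esub>y\<in>{x}. free_gen K X x y \<odot>\<^bsub>W\<^esub> \<phi> y)"
    using x by (intro linear_ext_eq[OF assms(1,2)]) (auto simp: free_gen_def)
  also have "\<dots> = \<phi> x"
    using x funcset_mem[OF \<phi> x] by (subst W.M.finsum_insert) (auto simp: free_gen_def)
  finally show ?thesis .
qed

end


section \<open>Positions in a composite tensor matrix\<close>

text \<open>On old indices, the map \<open>host_pos i n\<close> is inverse to the map \<open>\<sigma>\<close> of the paper, which is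
  \<^const>\<open>old_pos\<close>.\<close>

definition host_pos :: "nat \<Rightarrow> nat \<Rightarrow> nat \<Rightarrow> nat"
  where "host_pos i n p = (if p < i then p else p + (n - 1))"

lemma host_pos_old: "n \<ge> 1 \<Longrightarrow> \<not> new_index i n (host_pos i n p)"
  by (auto simp: host_pos_def new_index_def)

text \<open>The restriction to old \<open>a\<close> matters: on new indices \<open>old_pos\<close>
  takes values that it also takes on old ones. For i = 2 and n = 3 the new index 3 and the old index
  1 both go to 1.\<close>

lemma old_pos_eq_iff:
  "\<lbrakk>n \<ge> 1; \<not> new_index i n a\<rbrakk> \<Longrightarrow> old_pos i n a = p \<longleftrightarrow> a = host_pos i n p"
  by (auto simp: host_pos_def old_pos_def new_index_def)

lemma old_pos_host_pos: "n \<ge> 1 \<Longrightarrow> old_pos i n (host_pos i n p) = p"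
  by (simp add: old_pos_eq_iff host_pos_old)

lemma host_pos_upper_pairs:
  "\<lbrakk>1 \<le> m; 1 \<le> n; (p, q) \<in> upper_pairs (m - 1)\<rbrakk> \<Longrightarrow>
    (host_pos i n p, host_pos i n q) \<in> upper_pairs (m + n - 2)"
  by (auto simp: upper_pairs_def host_pos_def)

lemma new_upper_pairs:
  "\<lbrakk>1 \<le> i; i \<le> m; (p, q) \<in> upper_pairs (n - 1)\<rbrakk> \<Longrightarrow>
    (p + i - 1, q + i - 1) \<in> upper_pairs (m + n - 2)"
  by (auto simp: upper_pairs_def)

lemma diamond_entries_old:
  assumes "1 \<le> m" "1 \<le> n" "(p, q) \<in> upper_pairs (m - 1)"
  shows "diamond_entries m n i u w v (host_pos i n p, host_pos i n q) = u (p, q)"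
  using host_pos_upper_pairs[OF assms, of i] assms(2)
  by (simp add: diamond_entries_def host_pos_old old_pos_host_pos)

lemma diamond_entries_new:
  assumes "1 \<le> i" "i \<le> m" "(p, q) \<in> upper_pairs (n - 1)"
  shows "diamond_entries m n i u w v (p + i - 1, q + i - 1) = v (p, q)"
proof -
  have "new_index i n (p + i - 1)" "new_index i n (q + i - 1)"
    and "p + i - 1 - i + 1 = p" "q + i - 1 - i + 1 = q"
    using assms by (auto simp: upper_pairs_def new_index_def)
  then show ?thesis
    using new_upper_pairs[OF assms] by (simp add: diamond_entries_def del: One_nat_def)
qed

text \<open>\<open>host_pos\<close> inverts \<open>old_pos\<close> on old indices, so the entry of
  \<open>u\<close> at (p,q) is read at one position only. With its analogues for \<open>v\<close>
  and \<open>w\<close> this is what makes the composite multilinear in each argument.\<close>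

lemma diamond_entries_upd_old:
  assumes "1 \<le> m" "1 \<le> n" "(p, q) \<in> upper_pairs (m - 1)"
  shows "diamond_entries m n i (u((p, q) := x)) w v =
    (diamond_entries m n i u w v)((host_pos i n p, host_pos i n q) := x)"
proof (rule ext, clarify)
  fix a b
  show "diamond_entries m n i (u((p, q) := x)) w v (a, b) =
    ((diamond_entries m n i u w v)((host_pos i n p, host_pos i n q) := x)) (a, b)"
  proof (cases "(a, b) = (host_pos i n p, host_pos i n q)")
    case True
    then show ?thesis
      using diamond_entries_old[OF assms, of i "u((p, q) := x)" w v] by simp
  next
    case False
    then have "(u((p, q) := x)) (old_pos i n a, old_pos i n b) = u (old_pos i n a, old_pos i n b)"
      if "\<not> new_index i n a" "\<not> new_index i n b"
      using assms(2) that by (auto simp: old_pos_eq_iff)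
    then show ?thesis
      unfolding fun_upd_other[OF False] diamond_entries_def restrict_def split_conv
      by (cases "new_index i n a"; cases "new_index i n b"; simp del: fun_upd_apply One_nat_def)
  qed
qed

lemma diamond_entries_upd_new:
  assumes "1 \<le> i" "i \<le> m" "(p, q) \<in> upper_pairs (n - 1)"
  shows "diamond_entries m n i u w (v((p, q) := x)) =
    (diamond_entries m n i u w v)((p + i - 1, q + i - 1) := x)"
proof (rule ext, clarify)
  fix a b
  show "diamond_entries m n i u w (v((p, q) := x)) (a, b) =
    ((diamond_entries m n i u w v)((p + i - 1, q + i - 1) := x)) (a, b)"
  proof (cases "(a, b) = (p + i - 1, q + i - 1)")
    case True
    then show ?thesis
      using diamond_entries_new[OF assms, of u w "v((p, q) := x)"] by simp
  next
    case False
    then have "(v((p, q) := x)) (a - i + 1, b - i + 1) = v (a - i + 1, b - i + 1)"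
      if "new_index i n a" "new_index i n b"
      using assms(1) that by (auto simp: new_index_def)
    then show ?thesis
      unfolding fun_upd_other[OF False] diamond_entries_def restrict_def split_conv
      by (cases "new_index i n a"; cases "new_index i n b"; simp del: fun_upd_apply One_nat_def)
  qed
qed

text \<open>The place in the composite where the entry of the middle matrix in row r and column s
  appears. The test \<open>r < i\<close> decides on which side of the block of new indices the old
  index lies, so that the pair comes out increasing.\<close>

definition mixed_pos :: "nat \<Rightarrow> nat \<Rightarrow> nat \<times> nat \<Rightarrow> nat \<times> nat"
  where "mixed_pos i n = (\<lambda>(r, s).
    if r < i then (host_pos i n r, s + i - 1) else (s + i - 1, host_pos i n r))"

lemma mixed_pos_upper_pairs:
  "\<lbrakk>1 \<le> m; 1 \<le> n; 1 \<le> i; i \<le> m; rs \<in> B_pairs m n\<rbrakk> \<Longrightarrow> mixed_pos i n rs \<in> upper_pairs (m + n - 2)"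
  by (cases rs) (auto simp: upper_pairs_def B_pairs_def mixed_pos_def host_pos_def)

text \<open>New indices form an interval, so an old index smaller than a new one lies below
  \<open>i\<close>. In the companion \<open>mixed_pos_eqI'\<close> the old index is the larger one
  and lies beyond the block.\<close>

lemma mixed_pos_eqI:
  assumes "1 \<le> i" "a < b" "new_index i n b" "\<not> new_index i n a"
  shows "(a, b) = mixed_pos i n (old_pos i n a, b - i + 1)"
proof -
  have "a < i" "i \<le> b"
    using assms by (auto simp: new_index_def)
  then show ?thesis
    using assms(1) by (simp add: mixed_pos_def host_pos_def old_pos_def)
qed

lemma mixed_pos_eqI':
  assumes "1 \<le> i" "a < b" "new_index i n a" "\<not> new_index i n b"
  shows "(a, b) = mixed_pos i n (old_pos i n b, a - i + 1)"
proof -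
  have "i \<le> a" "i + (n - 1) \<le> b"
    using assms by (auto simp: new_index_def)
  then show ?thesis
    using assms(1,2) by (simp add: mixed_pos_def host_pos_def old_pos_def)
qed

lemma diamond_entries_mixed:
  assumes "1 \<le> m" "1 \<le> n" "1 \<le> i" "i \<le> m" "rs \<in> B_pairs m n"
  shows "diamond_entries m n i u w v (mixed_pos i n rs) = w rs"
proof -
  obtain r s where rs: "rs = (r, s)" by (cases rs)
  have s: "new_index i n (s + i - 1)" "s + i - 1 - i + 1 = s"
    using assms by (auto simp: rs B_pairs_def new_index_def)
  note pos = mixed_pos_upper_pairs[OF assms, unfolded rs mixed_pos_def split_conv]
    host_pos_old[OF assms(2), of i r] old_pos_host_pos[OF assms(2), of i r]
  show ?thesis
  proof (cases "r < i")
    case True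
    then show ?thesis
      using pos s by (simp add: rs mixed_pos_def diamond_entries_def del: One_nat_def)
  next
    case False
    then show ?thesis
      using pos s by (simp add: rs mixed_pos_def diamond_entries_def del: One_nat_def)
  qed
qed

lemma diamond_entries_upd_mixed:
  assumes "1 \<le> m" "1 \<le> n" "1 \<le> i" "i \<le> m" "rs \<in> B_pairs m n"
  shows "diamond_entries m n i u (w(rs := x)) v =
    (diamond_entries m n i u w v)(mixed_pos i n rs := x)"
proof (rule ext, clarify)
  fix a b
  show "diamond_entries m n i u (w(rs := x)) v (a, b) =
    ((diamond_entries m n i u w v)(mixed_pos i n rs := x)) (a, b)"
  proof (cases "(a, b) = mixed_pos i n rs")
    case True
    then show ?thesis
      unfolding True using diamond_entries_mixed[OF assms, of u "w(rs := x)" v] by simp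
  next
    case False
    have "(w(rs := x)) (old_pos i n a, b - i + 1) = w (old_pos i n a, b - i + 1)"
      if "a < b" "new_index i n b" "\<not> new_index i n a"
      using False mixed_pos_eqI[OF assms(3) that] by (metis fun_upd_other)
    moreover have "(w(rs := x)) (old_pos i n b, a - i + 1) = w (old_pos i n b, a - i + 1)"
      if "a < b" "new_index i n a" "\<not> new_index i n b"
      using False mixed_pos_eqI'[OF assms(3) that] by (metis fun_upd_other)
    \<comment> \<open>Off \<open>upper_pairs\<close> both sides are undefined, so only increasing
      pairs remain, and these are the ones that \<open>mixed_pos\<close> produces.\<close>
    moreover have "a < b" if "(a, b) \<in> upper_pairs (m + n - 2)"
      using that by (simp add: upper_pairs_def)
    ultimately show ?thesis
      unfolding fun_upd_other[OF False] diamond_entries_def restrict_def split_conv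
      by (cases "new_index i n a"; cases "new_index i n b"; simp del: fun_upd_apply One_nat_def)
  qed
qed

text \<open>The premise of 2-alternation, separated from \<phi> so that the matrices satisfying it
  can be collected and composed.\<close>

definition has_triangle :: "nat \<Rightarrow> (nat \<times> nat \<Rightarrow> 'v) \<Rightarrow> bool"
  where "has_triangle n v \<longleftrightarrow>
    (\<exists>i j l. 1 \<le> i \<and> i < j \<and> j < l \<and> l \<le> n \<and> v (i, j) = v (i, l) \<and> v (i, l) = v (j, l))"

lemma has_triangleI:
  assumes "(p, q) \<in> upper_pairs n" "(q, r) \<in> upper_pairs n"
    and "v (p, q) = v (p, r)" "v (p, r) = v (q, r)"
  shows "has_triangle n v"
  unfolding has_triangle_def using assms
  by (intro exI[of _ p] exI[of _ q] exI[of _ r]) (auto simp: upper_pairs_def)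

lemma has_triangleE:
  assumes "has_triangle n v"
  obtains p q r where "(p, q) \<in> upper_pairs n" "(p, r) \<in> upper_pairs n" "(q, r) \<in> upper_pairs n"
    and "v (p, q) = v (p, r)" "v (p, r) = v (q, r)"
  using assms by (force simp: has_triangle_def upper_pairs_def)

lemma has_triangle_diamond_old:
  assumes mn: "1 \<le> m" "1 \<le> n" and "has_triangle (m - 1) u"
  shows "has_triangle (m + n - 2) (diamond_entries m n i u w v)"
  using assms(3)
proof (rule has_triangleE)
  fix p q r
  assume t: "(p, q) \<in> upper_pairs (m - 1)" "(p, r) \<in> upper_pairs (m - 1)" "(q, r) \<in> upper_pairs (m - 1)"
    and "u (p, q) = u (p, r)" "u (p, r) = u (q, r)"
  then show ?thesis
    using t[THEN host_pos_upper_pairs[OF mn, where i = i]]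
      t[THEN diamond_entries_old[OF mn, where i = i and u = u and v = v and w = w]]
    by (intro has_triangleI[of "host_pos i n p" "host_pos i n q" _ "host_pos i n r"]) simp_all
qed

lemma has_triangle_diamond_new:
  assumes i: "1 \<le> i" "i \<le> m" and "has_triangle (n - 1) v"
  shows "has_triangle (m + n - 2) (diamond_entries m n i u w v)"
  using assms(3)
proof (rule has_triangleE)
  fix p q r
  assume t: "(p, q) \<in> upper_pairs (n - 1)" "(p, r) \<in> upper_pairs (n - 1)" "(q, r) \<in> upper_pairs (n - 1)"
    and "v (p, q) = v (p, r)" "v (p, r) = v (q, r)"
  then show ?thesis
    using t[THEN new_upper_pairs[OF i]]
      t[THEN diamond_entries_new[OF i, where u = u and v = v and w = w]]
    by (intro has_triangleI[of "p + i - 1" "q + i - 1" _ "r + i - 1"]) simp_all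
qed


section \<open>Tensor powers\<close>

locale tensor_powers = vectorspace K V for K :: "'k ring" and V :: "('k, 'v) module"
begin

sublocale scalar_ring K ..

lemma family_upd [intro, simp]:
  "\<lbrakk>u \<in> families V S; s \<in> S; x \<in> carrier V\<rbrakk> \<Longrightarrow> u(s := x) \<in> families V S"
  by (auto simp: PiE_iff extensional_def)

lemma multilinearI:
  assumes "\<And>u. u \<in> families V S \<Longrightarrow> \<phi> u \<in> carrier W"
    and "\<And>u s x y. \<lbrakk>u \<in> families V S; s \<in> S; x \<in> carrier V; y \<in> carrier V\<rbrakk> \<Longrightarrow>
      \<phi> (u(s := x \<oplus>\<^bsub>V\<^esub> y)) = \<phi> (u(s := x)) \<oplus>\<^bsub>W\<^esub> \<phi> (u(s := y))"
    and "\<And>u s c x. \<lbrakk>u \<in> families V S; s \<in> S; c \<in> carrier K; x \<in> carrier V\<rbrakk> \<Longrightarrow>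
      \<phi> (u(s := c \<odot>\<^bsub>V\<^esub> x)) = c \<odot>\<^bsub>W\<^esub> \<phi> (u(s := x))"
  shows "multilinear K V S W \<phi>"
  unfolding multilinear_def using assms by (auto intro!: module_homI)

lemma multilinear_closed:
  "\<lbrakk>multilinear K V S W \<phi>; u \<in> families V S\<rbrakk> \<Longrightarrow> \<phi> u \<in> carrier W"
  by (auto simp: multilinear_def)

lemma multilinear_add:
  "\<lbrakk>multilinear K V S W \<phi>; u \<in> families V S; s \<in> S; x \<in> carrier V; y \<in> carrier V\<rbrakk> \<Longrightarrow>
    \<phi> (u(s := x \<oplus>\<^bsub>V\<^esub> y)) = \<phi> (u(s := x)) \<oplus>\<^bsub>W\<^esub> \<phi> (u(s := y))"
  unfolding multilinear_def by (blast dest: module_hom_add)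

lemma multilinear_smult:
  "\<lbrakk>multilinear K V S W \<phi>; u \<in> families V S; s \<in> S; c \<in> carrier K; x \<in> carrier V\<rbrakk> \<Longrightarrow>
    \<phi> (u(s := c \<odot>\<^bsub>V\<^esub> x)) = c \<odot>\<^bsub>W\<^esub> \<phi> (u(s := x))"
  unfolding multilinear_def by (blast dest: module_hom_smult)

lemma tensor_rels_closed: "tensor_rels K V S \<subseteq> carrier (free_fam K V S)"
proof -
  interpret F: module K "free_fam K V S" by (rule module_free)
  show ?thesis
    by (auto simp: tensor_rels_def intro!: F.M.minus_closed F.M.a_closed F.smult_closed)
qed

lemma tensor_null_submodule: "submodule K (tensor_null K V S) (free_fam K V S)"
proof -
  interpret F: module K "free_fam K V S" by (rule module_free)
  show ?thesis
    unfolding tensor_null_def by (rule F.span_is_submodule[OF tensor_rels_closed])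
qed

lemma tensor_quotient: "quotient_module K (free_fam K V S) (tensor_null K V S)"
  by (simp add: quotient_module_def quotient_module_axioms_def module_free tensor_null_submodule)

lemma tensor_rels_null: "tensor_rels K V S \<subseteq> tensor_null K V S"
proof -
  interpret F: module K "free_fam K V S" by (rule module_free)
  show ?thesis
    unfolding tensor_null_def by (rule F.in_own_span[OF tensor_rels_closed])
qed

lemma module_tensor: "module K (tensor_space K V S)"
  unfolding tensor_space_def by (rule quotient_module.module_quot[OF tensor_quotient])

lemma simple_tensor_closed [intro, simp]:
  "u \<in> families V S \<Longrightarrow> simple_tensor K V S u \<in> carrier (tensor_space K V S)"
  unfolding tensor_space_def simple_tensor_def
  by (intro quotient_module.coset_in_quot[OF tensor_quotient] free_gen_closed)

text \<open>Each law of multilinearity says that a certain difference of generators lies in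
  \<open>tensor_null\<close>, and that difference is one of the defining relations.\<close>

lemma simple_tensor_multilinear: "multilinear K V S (tensor_space K V S) (simple_tensor K V S)"
proof -
  interpret T: quotient_module K "free_fam K V S" "tensor_null K V S" by (rule tensor_quotient)
  show ?thesis
  proof (rule multilinearI)
    fix u s x y assume asm: "u \<in> families V S" "s \<in> S" "x \<in> carrier V" "y \<in> carrier V"
    have "fam_gen K V S (u(s := x \<oplus>\<^bsub>V\<^esub> y)) \<ominus>\<^bsub>free_fam K V S\<^esub>
       (fam_gen K V S (u(s := x)) \<oplus>\<^bsub>free_fam K V S\<^esub> fam_gen K V S (u(s := y))) \<in> tensor_null K V S"
      using asm by (intro subsetD[OF tensor_rels_null]) (unfold tensor_rels_def, blast)
    then show "simple_tensor K V S (u(s := x \<oplus>\<^bsub>V\<^esub> y)) =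
        simple_tensor K V S (u(s := x)) \<oplus>\<^bsub>tensor_space K V S\<^esub> simple_tensor K V S (u(s := y))"
      using asm by (simp add: simple_tensor_def tensor_space_def T.coset_eq_iff)
  next
    fix u s c x assume asm: "u \<in> families V S" "s \<in> S" "c \<in> carrier K" "x \<in> carrier V"
    have "fam_gen K V S (u(s := c \<odot>\<^bsub>V\<^esub> x)) \<ominus>\<^bsub>free_fam K V S\<^esub>
       (c \<odot>\<^bsub>free_fam K V S\<^esub> fam_gen K V S (u(s := x))) \<in> tensor_null K V S"
      using asm by (intro subsetD[OF tensor_rels_null]) (unfold tensor_rels_def, blast)
    then show "simple_tensor K V S (u(s := c \<odot>\<^bsub>V\<^esub> x)) =
        c \<odot>\<^bsub>tensor_space K V S\<^esub> simple_tensor K V S (u(s := x))"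
      using asm by (simp add: simple_tensor_def tensor_space_def T.coset_eq_iff)
  qed simp
qed

text \<open>Pulled back along the coset map, the span becomes a submodule of the free module that
  contains every generator, hence everything.\<close>

lemma tensor_space_generated:
  "LinearCombinations.module.span K (tensor_space K V S) (simple_tensor K V S ` families V S) =
    carrier (tensor_space K V S)"
proof -
  interpret T: quotient_module K "free_fam K V S" "tensor_null K V S" by (rule tensor_quotient)
  interpret Q: module K "tensor_space K V S" by (rule module_tensor)
  let ?N = "LinearCombinations.module.span K (tensor_space K V S) (simple_tensor K V S ` families V S)"
  let ?P = "{f \<in> carrier (free_fam K V S). tensor_null K V S +>\<^bsub>free_fam K V S\<^esub> f \<in> ?N}"
  have N: "submodule K ?N (tensor_space K V S)"
    by (rule Q.span_is_submodule) auto
  have "submodule K ?P (free_fam K V S)"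
    using T.coset_hom N unfolding tensor_space_def
    by (intro submodule_vimage[OF T.module_axioms T.module_quot])
  moreover have "simple_tensor K V S u \<in> ?N" if "u \<in> families V S" for u
    using that Q.in_own_span[of "simple_tensor K V S ` families V S"] by auto
  then have "fam_gen K V S ` families V S \<subseteq> ?P"
    by (auto simp: simple_tensor_def)
  ultimately have "LinearCombinations.module.span K (free_fam K V S) (fam_gen K V S ` families V S) \<subseteq> ?P"
    by (intro T.span_is_subset)
  then have "carrier (tensor_space K V S) \<subseteq> ?N"
    unfolding free_space_generated tensor_space_def T.carrier_quot by blast
  then show ?thesis
    using Q.span_is_subset2[of "simple_tensor K V S ` families V S"] by auto
qed

section \<open>The universal property of tensor powers\<close>

context
  fixes S :: "'i set" and W :: "('k, 'w) module" and \<phi> :: "('i \<Rightarrow> 'v) \<Rightarrow> 'w"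
  assumes W: "module K W" and \<phi>: "multilinear K V S W \<phi>"
begin

interpretation W: module K W by (rule W)

lemma multilinear_funcset: "\<phi> \<in> families V S \<rightarrow> carrier W"
  using \<phi> by (simp add: multilinear_def)

text \<open>Multilinearity of \<phi> makes the linear extension vanish on each defining relation;
  its kernel is a submodule and so contains their span.\<close>

lemma linear_ext_null:
  assumes f: "f \<in> tensor_null K V S"
  shows "linear_ext K (families V S) W \<phi> f = \<zero>\<^bsub>W\<^esub>"
proof -
  let ?h = "linear_ext K (families V S) W \<phi>"
  interpret h: mod_hom K "free_fam K V S" W ?h
    by (intro mod_homI module_free W linear_ext_hom multilinear_funcset)
  have gen: "?h (fam_gen K V S u) = \<phi> u" if "u \<in> families V S" for u
    by (rule linear_ext_gen[OF W multilinear_funcset that])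
  note closed = multilinear_closed[OF \<phi>]
  have "tensor_rels K V S \<subseteq> {f \<in> carrier (free_fam K V S). ?h f \<in> {\<zero>\<^bsub>W\<^esub>}}"
  proof
    fix r assume r: "r \<in> tensor_rels K V S"
    from r have "?h r = \<zero>\<^bsub>W\<^esub>"
      unfolding tensor_rels_def
    proof (elim UnE CollectE exE conjE)
      fix u s x y
      assume asm: "u \<in> families V S" "s \<in> S" "x \<in> carrier V" "y \<in> carrier V"
        and "r = fam_gen K V S (u(s := x \<oplus>\<^bsub>V\<^esub> y)) \<ominus>\<^bsub>free_fam K V S\<^esub>
          (fam_gen K V S (u(s := x)) \<oplus>\<^bsub>free_fam K V S\<^esub> fam_gen K V S (u(s := y)))"
      then show ?thesis
        by (simp add: gen multilinear_add[OF \<phi>] closed a_minus_def W.M.r_neg)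
    next
      fix u s c x
      assume asm: "u \<in> families V S" "s \<in> S" "c \<in> carrier K" "x \<in> carrier V"
        and "r = fam_gen K V S (u(s := c \<odot>\<^bsub>V\<^esub> x)) \<ominus>\<^bsub>free_fam K V S\<^esub>
          (c \<odot>\<^bsub>free_fam K V S\<^esub> fam_gen K V S (u(s := x)))"
      then show ?thesis
        by (simp add: gen multilinear_smult[OF \<phi>] closed a_minus_def W.M.r_neg)
    qed
    then show "r \<in> {f \<in> carrier (free_fam K V S). ?h f \<in> {\<zero>\<^bsub>W\<^esub>}}"
      using r tensor_rels_closed by blast
  qed
  moreover have "submodule K {f \<in> carrier (free_fam K V S). ?h f \<in> {\<zero>\<^bsub>W\<^esub>}} (free_fam K V S)"
    by (rule submodule_vimage[OF module_free W h.f_hom submodule_zero[OF W]])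
  ultimately have "tensor_null K V S \<subseteq> {f \<in> carrier (free_fam K V S). ?h f \<in> {\<zero>\<^bsub>W\<^esub>}}"
    unfolding tensor_null_def by (rule LinearCombinations.module.span_is_subset[OF module_free])
  then show ?thesis
    using f by blast
qed

text \<open>Resolves the definite description in \<open>tensor_lift\<close>: the candidates are the
  values at the representatives of one coset, and they all coincide.\<close>

lemma tensor_lift_coset:
  assumes f: "f \<in> carrier (free_fam K V S)"
  shows "tensor_lift K V S W \<phi> (tensor_null K V S +>\<^bsub>free_fam K V S\<^esub> f) =
    linear_ext K (families V S) W \<phi> f"
proof -
  interpret T: quotient_module K "free_fam K V S" "tensor_null K V S" by (rule tensor_quotient)
  \<comment> \<open>The factored map serves only to compare two representatives: its value depends
    on the coset alone.\<close>
  obtain h where h: "\<And>f. f \<in> carrier (free_fam K V S) \<Longrightarrow>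
      h (tensor_null K V S +>\<^bsub>free_fam K V S\<^esub> f) = linear_ext K (families V S) W \<phi> f"
    using T.hom_factors[OF W linear_ext_hom[OF W multilinear_funcset] linear_ext_null] by metis
  let ?C = "tensor_null K V S +>\<^bsub>free_fam K V S\<^esub> f"
  have "linear_ext K (families V S) W \<phi> g = linear_ext K (families V S) W \<phi> f" if "g \<in> ?C" for g
  proof -
    have g: "g \<in> carrier (free_fam K V S)"
      using that f T.N.a_elemrcos_carrier by blast
    have "?C = tensor_null K V S +>\<^bsub>free_fam K V S\<^esub> g"
      using that f by (rule T.N.a_repr_independence')
    then show ?thesis
      using h[OF f] h[OF g] by metis
  qed
  moreover have "f \<in> ?C"
    using f by (rule T.N.a_rcos_self)
  ultimately show ?thesis
    unfolding tensor_lift_def linear_ext_def[symmetric] by (intro the_equality) blast+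
qed

lemma tensor_lift_hom: "tensor_lift K V S W \<phi> \<in> module_hom K (tensor_space K V S) W"
proof -
  interpret T: quotient_module K "free_fam K V S" "tensor_null K V S" by (rule tensor_quotient)
  note hom = linear_ext_hom[OF W multilinear_funcset]
  show ?thesis
    unfolding tensor_space_def
    by (rule module_homI; elim T.quot_cases;
        simp add: tensor_lift_coset module_hom_in[OF hom] module_hom_add[OF hom]
          module_hom_smult[OF hom])
qed

lemma tensor_lift_simple:
  "u \<in> families V S \<Longrightarrow> tensor_lift K V S W \<phi> (simple_tensor K V S u) = \<phi> u"
  by (simp add: simple_tensor_def tensor_lift_coset linear_ext_gen[OF W multilinear_funcset])

text \<open>It serves two purposes: level by level it places a composite in a given submodule, and
  with \<open>N\<close> zero it shows that the lift of a 2-alternating map kills the triangle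
  tensors.\<close>

lemma tensor_lift_in_submodule:
  assumes N: "submodule K N W" and X: "X \<subseteq> families V S" and \<phi>X: "\<And>u. u \<in> X \<Longrightarrow> \<phi> u \<in> N"
    and t: "t \<in> LinearCombinations.module.span K (tensor_space K V S) (simple_tensor K V S ` X)"
  shows "tensor_lift K V S W \<phi> t \<in> N"
proof -
  let ?P = "{t \<in> carrier (tensor_space K V S). tensor_lift K V S W \<phi> t \<in> N}"
  have "submodule K ?P (tensor_space K V S)"
    by (rule submodule_vimage[OF module_tensor W tensor_lift_hom N])
  moreover have "simple_tensor K V S ` X \<subseteq> ?P"
    using X \<phi>X by (auto simp: tensor_lift_simple)
  ultimately have "LinearCombinations.module.span K (tensor_space K V S) (simple_tensor K V S ` X) \<subseteq> ?P"
    by (intro LinearCombinations.module.span_is_subset[OF module_tensor])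
  then show ?thesis
    using t by blast
qed

end

lemma hom_eq_on_simple_tensors:
  assumes "module K W" and "f \<in> module_hom K (tensor_space K V S) W"
    and "g \<in> module_hom K (tensor_space K V S) W"
    and "\<And>u. u \<in> families V S \<Longrightarrow> f (simple_tensor K V S u) = g (simple_tensor K V S u)"
    and "t \<in> carrier (tensor_space K V S)"
  shows "f t = g t"
proof (rule module_hom_eq_on_span[OF module_tensor assms(1-3)])
  show "simple_tensor K V S ` families V S \<subseteq> carrier (tensor_space K V S)"
    by auto
  show "t \<in> LinearCombinations.module.span K (tensor_space K V S) (simple_tensor K V S ` families V S)"
    unfolding tensor_space_generated by (rule assms(5))
qed (use assms(4) in blast)

text \<open>Lifting over one family keeps multilinearity in another. Both sides of each law are
  homomorphisms in \<open>t\<close>, so it is enough to compare them on simple tensors, where the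
  lift takes the value \<open>\<phi> w v\<close> and the law is the hypothesis on
  \<open>\<phi>'\<close>.\<close>

lemma tensor_lift_multilinear:
  assumes W: "module K W"
    and \<phi>: "\<And>w. w \<in> families V S' \<Longrightarrow> multilinear K V S W (\<phi> w)"
    and \<phi>': "\<And>v. v \<in> families V S \<Longrightarrow> multilinear K V S' W (\<lambda>w. \<phi> w v)"
    and t: "t \<in> carrier (tensor_space K V S)"
  shows "multilinear K V S' W (\<lambda>w. tensor_lift K V S W (\<phi> w) t)"
proof (rule multilinearI)
  note hom = tensor_lift_hom[OF W \<phi>] and simple = tensor_lift_simple[OF W \<phi>]
  show "tensor_lift K V S W (\<phi> w) t \<in> carrier W" if "w \<in> families V S'" for w
    using module_hom_in[OF hom[OF that] t] .
  fix w s x assume w: "w \<in> families V S'" "s \<in> S'" and x: "x \<in> carrier V"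
  have upd: "w(s := z) \<in> families V S'" if "z \<in> carrier V" for z
    using w that by (rule family_upd)
  show "tensor_lift K V S W (\<phi> (w(s := x \<oplus>\<^bsub>V\<^esub> y))) t =
      tensor_lift K V S W (\<phi> (w(s := x))) t \<oplus>\<^bsub>W\<^esub> tensor_lift K V S W (\<phi> (w(s := y))) t"
    if y: "y \<in> carrier V" for y
  proof (rule hom_eq_on_simple_tensors[OF W hom _ _ t])
    show "w(s := x \<oplus>\<^bsub>V\<^esub> y) \<in> families V S'"
      using x y by (intro upd M.a_closed)
    then show "tensor_lift K V S W (\<phi> (w(s := x \<oplus>\<^bsub>V\<^esub> y))) (simple_tensor K V S v) =
        tensor_lift K V S W (\<phi> (w(s := x))) (simple_tensor K V S v) \<oplus>\<^bsub>W\<^esub>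
        tensor_lift K V S W (\<phi> (w(s := y))) (simple_tensor K V S v)"
      if "v \<in> families V S" for v
      unfolding simple[OF upd[OF x] that] simple[OF upd[OF y] that]
      using multilinear_add[OF \<phi>'[OF that] w x y] simple that by metis
  qed (rule module_hom_plus[OF W hom[OF upd[OF x]] hom[OF upd[OF y]] module_tensor])
  show "tensor_lift K V S W (\<phi> (w(s := c \<odot>\<^bsub>V\<^esub> x))) t =
      c \<odot>\<^bsub>W\<^esub> tensor_lift K V S W (\<phi> (w(s := x))) t"
    if c: "c \<in> carrier K" for c
  proof (rule hom_eq_on_simple_tensors[OF W hom _ _ t])
    show "w(s := c \<odot>\<^bsub>V\<^esub> x) \<in> families V S'"
      using x c by (intro upd smult_closed)
    then show "tensor_lift K V S W (\<phi> (w(s := c \<odot>\<^bsub>V\<^esub> x))) (simple_tensor K V S v) =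
        c \<odot>\<^bsub>W\<^esub> tensor_lift K V S W (\<phi> (w(s := x))) (simple_tensor K V S v)"
      if "v \<in> families V S" for v
      unfolding simple[OF upd[OF x] that]
      using multilinear_smult[OF \<phi>'[OF that] w c x] simple that by metis
  qed (rule module_hom_scale[OF W hom[OF upd[OF x]] c])
qed

text \<open>Multilinearity at a position \<open>s\<close> involves only updates at \<open>s\<close>.
  These become updates at \<open>\<pi> s\<close>, where the multilinearity of simple tensors
  applies.\<close>

lemma simple_tensor_reindex:
  assumes g: "\<And>u. u \<in> families V S \<Longrightarrow> g u \<in> families V S'"
    and \<pi>: "\<And>s. s \<in> S \<Longrightarrow> \<pi> s \<in> S'"
    and upd: "\<And>u s x. \<lbrakk>u \<in> families V S; s \<in> S; x \<in> carrier V\<rbrakk> \<Longrightarrow> g (u(s := x)) = (g u)(\<pi> s := x)"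
  shows "multilinear K V S (tensor_space K V S') (\<lambda>u. simple_tensor K V S' (g u))"
  using g \<pi>
  by (intro multilinearI) (simp_all add: upd multilinear_add[OF simple_tensor_multilinear]
      multilinear_smult[OF simple_tensor_multilinear])

section \<open>Transposition and the operations on tensors\<close>

lemma diamond_entries_closed:
  assumes m: "1 \<le> m" and n: "1 \<le> n" and i: "1 \<le> i" "i \<le> m"
    and uwv: "u \<in> families V (upper_pairs (m - 1))" "w \<in> families V (B_pairs m n)"
      "v \<in> families V (upper_pairs (n - 1))"
  shows "diamond_entries m n i u w v \<in> families V (upper_pairs (m + n - 2))"
proof (rule PiE_I, clarify)
  fix a b assume ab: "(a, b) \<in> upper_pairs (m + n - 2)"
  consider "\<not> new_index i n a" "\<not> new_index i n b" | "new_index i n a" "new_index i n b"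
    | "\<not> new_index i n a" "new_index i n b" | "new_index i n a" "\<not> new_index i n b"
    by blast
  then show "diamond_entries m n i u w v (a, b) \<in> carrier V"
  proof cases
    case 1
    then have "(old_pos i n a, old_pos i n b) \<in> upper_pairs (m - 1)"
      using ab m n i by (auto simp: old_pos_def new_index_def upper_pairs_def)
    then show ?thesis
      using 1 ab uwv by (auto simp: diamond_entries_def)
  next
    case 2
    then have "(a - i + 1, b - i + 1) \<in> upper_pairs (n - 1)"
      using ab m n i by (auto simp: new_index_def upper_pairs_def)
    then show ?thesis
      using 2 ab uwv by (auto simp: diamond_entries_def)
  next
    case 3
    then have "(old_pos i n a, b - i + 1) \<in> B_pairs m n"
      using ab m n i by (auto simp: old_pos_def new_index_def upper_pairs_def B_pairs_def)
    then show ?thesis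
      using 3 ab uwv by (auto simp: diamond_entries_def)
  next
    case 4
    then have "(old_pos i n b, a - i + 1) \<in> B_pairs m n"
      using ab m n i by (auto simp: old_pos_def new_index_def upper_pairs_def B_pairs_def)
    then show ?thesis
      using 4 ab uwv by (auto simp: diamond_entries_def)
  qed
qed (simp add: diamond_entries_def)

text \<open>This is all that the second ideal condition asks of the transpose: triangles of a
  composite are found among the entries of an outer argument, whatever the middle one is.\<close>

lemma B_transpose_closed:
  assumes "A \<in> carrier (B_space K V m n)"
  shows "B_transpose K V m n A \<in> carrier (B_space K V n m)"
  unfolding B_transpose_def B_space_def
proof (rule module_hom_in[OF tensor_lift_hom[OF module_tensor]])
  show "multilinear K V (B_pairs m n) (tensor_space K V (B_pairs n m))
      (\<lambda>w. simple_tensor K V (B_pairs n m) (\<lambda>(r, s)\<in>B_pairs n m. w (s, r)))"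
  proof (rule simple_tensor_reindex[where \<pi> = prod.swap])
    show "(\<lambda>(r, s)\<in>B_pairs n m. (w(t := x)) (s, r)) = (\<lambda>(r, s)\<in>B_pairs n m. w (s, r))(prod.swap t := x)"
      if "t \<in> B_pairs m n" for w t and x :: 'v
      using that by (auto simp: B_pairs_def fun_eq_iff)
  qed (auto simp: B_pairs_def)
qed (use assms in \<open>simp add: B_space_def\<close>)

text \<open>Separate sets \<open>X\<close> and \<open>Y\<close> let one statement serve both ideal
  conditions: the outer argument in J is restricted to triangle matrices, and the other one ranges
  over all matrices.\<close>

lemma diamond_in_submodule:
  assumes m: "1 \<le> m" and n: "1 \<le> n" and i: "1 \<le> i" "i \<le> m"
    and N: "submodule K N (T_space K V (m + n - 1))"
    and X: "X \<subseteq> families V (upper_pairs (m - 1))" and Y: "Y \<subseteq> families V (upper_pairs (n - 1))"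
    and x: "x \<in> LinearCombinations.module.span K (T_space K V m) (T_simple K V m ` X)"
    and A: "A \<in> carrier (B_space K V m n)"
    and y: "y \<in> LinearCombinations.module.span K (T_space K V n) (T_simple K V n ` Y)"
    and mem: "\<And>u w v. \<lbrakk>u \<in> X; w \<in> families V (B_pairs m n); v \<in> Y\<rbrakk> \<Longrightarrow>
      T_simple K V (m + n - 1) (diamond_entries m n i u w v) \<in> N"
  shows "diamond K V m n i x A y \<in> N"
proof -
  let ?U = "upper_pairs (m - 1)" and ?B = "B_pairs m n" and ?U' = "upper_pairs (n - 1)"
  let ?S = "upper_pairs (m + n - 2)"
  let ?W = "tensor_space K V ?S"
  define D where "D u w v = simple_tensor K V ?S (diamond_entries m n i u w v)" for u w v
  note W = module_tensor[where S = ?S]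
  note closed = diamond_entries_closed[OF m n i]
  \<comment> \<open>The space of index m + n - 1 has matrices of size one less, which is the size m
    + n - 2 of the composite.\<close>
  have T_simple: "T_simple K V (m + n - 1) = simple_tensor K V ?S"
    and T_space: "T_space K V (m + n - 1) = ?W"
    by (simp_all add: T_simple_def T_space_def fun_eq_iff numeral_2_eq_2)
  have y': "y \<in> carrier (tensor_space K V ?U')"
    using LinearCombinations.module.span_is_subset2[OF module_tensor, of "simple_tensor K V ?U' ` Y"] Y y
    by (auto simp: T_space_def T_simple_def[abs_def])
  have v: "multilinear K V ?U' ?W (D u w)" if "u \<in> families V ?U" "w \<in> families V ?B" for u w
    unfolding D_def
  proof (rule simple_tensor_reindex[where \<pi> = "\<lambda>(p, q). (p + i - 1, q + i - 1)"])
    show "(case s of (p, q) \<Rightarrow> (p + i - 1, q + i - 1)) \<in> ?S" if "s \<in> ?U'" for s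
      using that new_upper_pairs[OF i] by (cases s) simp
    show "diamond_entries m n i u w (v(s := x)) = (diamond_entries m n i u w v)
        ((case s of (p, q) \<Rightarrow> (p + i - 1, q + i - 1)) := x)" if "s \<in> ?U'" for v s x
      using that diamond_entries_upd_new[OF i] by (cases s) simp
  qed (use that closed in blast)
  have w: "multilinear K V ?B ?W (\<lambda>w. D u w v)" if "u \<in> families V ?U" "v \<in> families V ?U'" for u v
    unfolding D_def
    by (rule simple_tensor_reindex[OF _ mixed_pos_upper_pairs[OF m n i] diamond_entries_upd_mixed[OF m n i]])
      (use that closed in blast)
  have u: "multilinear K V ?U ?W (\<lambda>u. D u w v)" if "w \<in> families V ?B" "v \<in> families V ?U'" for w v
    unfolding D_def
  proof (rule simple_tensor_reindex[where \<pi> = "\<lambda>(p, q). (host_pos i n p, host_pos i n q)"])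
    show "(case s of (p, q) \<Rightarrow> (host_pos i n p, host_pos i n q)) \<in> ?S" if "s \<in> ?U" for s
      using that host_pos_upper_pairs[OF m n] by (cases s) simp
    show "diamond_entries m n i (u(s := x)) w v = (diamond_entries m n i u w v)
        ((case s of (p, q) \<Rightarrow> (host_pos i n p, host_pos i n q)) := x)" if "s \<in> ?U" for u s x
      using that diamond_entries_upd_old[OF m n] by (cases s) simp
  qed (use that closed in blast)
  \<comment> \<open>The two inner levels of \<open>diamond\<close>, with \<open>y\<close> and then
    \<open>A\<close> inserted. \<open>?G\<close> has to be multilinear in \<open>w\<close>, for the
    lift over \<open>A\<close> to be determined, and in \<open>u\<close>, to pass this on to
    \<open>?F\<close>.\<close>
  let ?G = "\<lambda>u w. tensor_lift K V ?U' ?W (D u w) y"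
  let ?F = "\<lambda>u. tensor_lift K V ?B ?W (?G u) A"
  have w': "multilinear K V ?B ?W (?G u)" if "u \<in> families V ?U" for u
    by (rule tensor_lift_multilinear[OF W v[OF that] w[OF that] y'])
  have u': "multilinear K V ?U ?W (\<lambda>u. ?G u w)" if "w \<in> families V ?B" for w
    by (rule tensor_lift_multilinear[OF W v[OF _ that] u[OF that] y'])
  have u'': "multilinear K V ?U ?W ?F"
    by (rule tensor_lift_multilinear[OF W w' u' A[unfolded B_space_def]])
  have N: "submodule K N ?W"
    using N unfolding T_space .
  have D_mem: "D u w v \<in> N" if "u \<in> X" "w \<in> families V ?B" "v \<in> Y" for u w v
    unfolding D_def by (rule mem[unfolded T_simple, OF that])
  have "?G u w \<in> N" if "u \<in> X" "w \<in> families V ?B" for u w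
    using y D_mem[OF that] that X unfolding T_simple_def[of K V n] T_space_def[of K V n]
    by (intro tensor_lift_in_submodule[OF W v N Y]) auto
  then have "?F u \<in> N" if "u \<in> X" for u
    using that X A by (intro tensor_lift_in_submodule[OF W w' N subset_refl])
      (auto simp: tensor_space_generated B_space_def)
  then have "tensor_lift K V ?U ?W ?F x \<in> N"
    using x unfolding T_simple_def[of K V m] T_space_def[of K V m]
    by (intro tensor_lift_in_submodule[OF W u'' N X])
  then show ?thesis
    unfolding diamond_def T_space T_simple D_def[abs_def] .
qed

section \<open>The triangle ideal and the exterior ideal\<close>

definition triangle_span :: "nat \<Rightarrow> ('k, 'v) mtensor set"
  where "triangle_span m = LinearCombinations.module.span K (T_space K V m)
    (T_simple K V m ` {u \<in> families V (upper_pairs (m - 1)). has_triangle (m - 1) u})"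

lemma triangle_span_submodule: "submodule K (triangle_span m) (T_space K V m)"
  unfolding triangle_span_def T_space_def T_simple_def
  by (rule LinearCombinations.module.span_is_submodule[OF module_tensor]) auto

lemma simple_in_triangle_span:
  assumes "u \<in> families V (upper_pairs (m - 1))" "has_triangle (m - 1) u"
  shows "T_simple K V m u \<in> triangle_span m"
proof -
  have "T_simple K V m ` {u \<in> families V (upper_pairs (m - 1)). has_triangle (m - 1) u}
      \<subseteq> triangle_span m"
    unfolding triangle_span_def T_space_def T_simple_def
    by (rule LinearCombinations.module.in_own_span[OF module_tensor]) auto
  then show ?thesis
    using assms by blast
qed

lemma T_space_generated:
  "LinearCombinations.module.span K (T_space K V m) (T_simple K V m ` families V (upper_pairs (m - 1))) =
    carrier (T_space K V m)"
  unfolding T_space_def T_simple_def by (rule tensor_space_generated)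

lemma vectorspace_T: "vectorspace K (T_space K V m)"
  by (simp add: vectorspace_def T_space_def module_tensor field_axioms)

lemma triangle_span_ideal: "T_ideal K V triangle_span"
  unfolding T_ideal_def
proof (intro conjI allI impI ballI)
  fix m show "subspace K (triangle_span m) (T_space K V m)"
    by (intro subspace.intro vectorspace_T triangle_span_submodule)
next
  fix m n x y A i
  assume m: "1 \<le> (m::nat)" and n: "1 \<le> (n::nat)" and x: "x \<in> triangle_span m"
    and y: "y \<in> carrier (T_space K V n)" and A: "A \<in> carrier (B_space K V m n)"
  show "diamond K V m n i x A y \<in> triangle_span (m + n - 1)" if "i \<in> {1..m}"
  proof (rule diamond_in_submodule[OF m n _ _ triangle_span_submodule _ subset_refl
        x[unfolded triangle_span_def] A y[folded T_space_generated]])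
    fix u w v
    assume "u \<in> {u \<in> families V (upper_pairs (m - 1)). has_triangle (m - 1) u}"
      "w \<in> families V (B_pairs m n)" "v \<in> families V (upper_pairs (n - 1))"
    then show "T_simple K V (m + n - 1) (diamond_entries m n i u w v) \<in> triangle_span (m + n - 1)"
      using m n that diamond_entries_closed[of m n i u w v] has_triangle_diamond_old[of m n u i w v]
      by (intro simple_in_triangle_span) (auto simp: numeral_2_eq_2)
  qed (use that in auto)
  \<comment> \<open>Now the triangle lies in the inserted matrix. The operation has the sizes in the
    order n, m, so the sum is commuted only at the end.\<close>
  have "diamond K V n m i y (B_transpose K V m n A) x \<in> triangle_span (n + m - 1)" if "i \<in> {1..n}"
  proof (rule diamond_in_submodule[OF n m _ _ triangle_span_submodule subset_refl _
        y[folded T_space_generated] B_transpose_closed[OF A] x[unfolded triangle_span_def]])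
    fix u w v
    assume "v \<in> {u \<in> families V (upper_pairs (m - 1)). has_triangle (m - 1) u}"
      "w \<in> families V (B_pairs n m)" "u \<in> families V (upper_pairs (n - 1))"
    then show "T_simple K V (n + m - 1) (diamond_entries n m i u w v) \<in> triangle_span (n + m - 1)"
      using m n that diamond_entries_closed[of n m i u w v] has_triangle_diamond_new[of i n m v u w]
      by (intro simple_in_triangle_span) (auto simp: numeral_2_eq_2)
  qed (use that in auto)
  then show "diamond K V n m i y (B_transpose K V m n A) x \<in> triangle_span (m + n - 1)" if "i \<in> {1..n}"
    using that by (simp add: add.commute)
qed

lemma E_generators_triangle: "E_generators K V m \<subseteq> triangle_span m"
proof (cases "m = 4")
  case True
  have "T_simple K V 4 (\<lambda>_\<in>upper_pairs 3. v) \<in> triangle_span 4" if "v \<in> carrier V" for v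
  proof (rule simple_in_triangle_span)
    \<comment> \<open>Matrices of index 4 use the indices 1, 2, 3, whose only triangle is 1 < 2 <
      3.\<close>
    show "has_triangle (4 - 1) (\<lambda>_\<in>upper_pairs 3. v)"
      by (rule has_triangleI[of 1 2 _ 3]) (auto simp: upper_pairs_def)
  qed (use that in auto)
  then show ?thesis
    using True by (auto simp: E_generators_def)
qed (simp add: E_generators_def)

lemma E_ideal_triangle: "E_ideal K V m \<subseteq> triangle_span m"
  unfolding E_ideal_def T_ideal_generated_def
  using triangle_span_ideal E_generators_triangle by blast

text \<open>An intersection of submodules, taken over a nonempty family since J belongs to it; this
  is what keeps it inside the carrier. For index 0 an ideal is unconstrained, hence the assumption
  on \<open>m\<close>.\<close>

lemma E_ideal_submodule:
  assumes "1 \<le> m"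
  shows "submodule K (E_ideal K V m) (T_space K V m)"
proof -
  have sub: "submodule K (I m) (T_space K V m)" if "T_ideal K V I" for I
    using that assms by (simp add: T_ideal_def subspace_def)
  have E_iff: "x \<in> E_ideal K V m \<longleftrightarrow>
      (\<forall>I. T_ideal K V I \<longrightarrow> (\<forall>l\<ge>1. E_generators K V l \<subseteq> I l) \<longrightarrow> x \<in> I m)" for x
    unfolding E_ideal_def T_ideal_generated_def by blast
  show ?thesis
  proof (rule LinearCombinations.submodule.intro)
    show "module K (T_space K V m)"
      unfolding T_space_def by (rule module_tensor)
    show "E_ideal K V m \<subseteq> carrier (T_space K V m)"
      using E_ideal_triangle submodule.subset[OF triangle_span_submodule] by blast
    show "\<zero>\<^bsub>T_space K V m\<^esub> \<in> E_ideal K V m"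
      unfolding E_iff using submodule.zero_closed[OF sub] by blast
  next
    fix v w assume "v \<in> E_ideal K V m" "w \<in> E_ideal K V m"
    then show "v \<oplus>\<^bsub>T_space K V m\<^esub> w \<in> E_ideal K V m"
      unfolding E_iff using submodule.m_closed[OF sub] by blast
  next
    fix c v assume "c \<in> carrier K" "v \<in> E_ideal K V m"
    then show "c \<odot>\<^bsub>T_space K V m\<^esub> v \<in> E_ideal K V m"
      unfolding E_iff using submodule.smult_closed[OF sub] by blast
  qed
qed

end


section \<open>Factorization of 2-alternating maps\<close>

theorem proposition3p1:
  fixes K :: "'k ring" and V :: "('k, 'v) module" and W :: "('k, 'w) module"
    and n :: nat and \<phi> :: "(nat \<times> nat \<Rightarrow> 'v) \<Rightarrow> 'w"
  assumes "field K" and "vectorspace K V" and "vectorspace K W"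
    and "multilinear K V (upper_pairs n) W \<phi>"
    and "two_alternating V n W \<phi>"
  shows "\<exists>!f. f \<in> extensional (carrier (Lambda_space K V (n + 1))) \<and>
    linear_map K (Lambda_space K V (n + 1)) W f \<and>
    (\<forall>v\<in>families V (upper_pairs n). f (alpha K V n v) = \<phi> v)"
proof -
  interpret tensor_powers K V
    using assms(2) by (rule tensor_powers.intro)
  interpret W: vectorspace K W by fact
  note W = W.module_axioms
  let ?T = "T_space K V (n + 1)" and ?E = "E_ideal K V (n + 1)"
  have T: "?T = tensor_space K V (upper_pairs n)"
    and T_simple: "T_simple K V (n + 1) = simple_tensor K V (upper_pairs n)"
    by (simp_all add: T_space_def T_simple_def fun_eq_iff)
  \<comment> \<open>The index n + 1 is at least 1 even for n = 0, so the exterior ideal is a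
    submodule here.\<close>
  interpret L: quotient_module K ?T ?E
    using vectorspace_T[of "n + 1"] E_ideal_submodule[of "n + 1"]
    by (simp add: quotient_module_def quotient_module_axioms_def vectorspace_def)
  have L: "Lambda_space K V (n + 1) = L.Q"
    by (simp add: Lambda_space_def)
  have linear_iff: "linear_map K L.Q W f \<longleftrightarrow> f \<in> module_hom K L.Q W" for f
    using L.module_quot W field_axioms
    by (simp add: linear_map_def mod_hom_def mod_hom_axioms_def vectorspace_def)
  have alpha: "alpha K V n v = ?E +>\<^bsub>?T\<^esub> simple_tensor K V (upper_pairs n) v" for v
    unfolding alpha_def T_simple ..
  have simple: "simple_tensor K V (upper_pairs n) v \<in> carrier ?T" if "v \<in> families V (upper_pairs n)" for v
    unfolding T using that by (rule simple_tensor_closed)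
  let ?h = "tensor_lift K V (upper_pairs n) W \<phi>"
  have h: "?h \<in> module_hom K ?T W"
    unfolding T by (rule tensor_lift_hom[OF W assms(4)])
  have ker: "?h t = \<zero>\<^bsub>W\<^esub>" if "t \<in> ?E" for t
  proof -
    let ?X = "{u \<in> families V (upper_pairs n). has_triangle n u}"
    have "t \<in> triangle_span (n + 1)"
      using that E_ideal_triangle by blast
    then have "t \<in> LinearCombinations.module.span K (tensor_space K V (upper_pairs n))
        (simple_tensor K V (upper_pairs n) ` ?X)"
      unfolding triangle_span_def T T_simple add_diff_cancel_right' .
    moreover have "\<phi> u \<in> {\<zero>\<^bsub>W\<^esub>}" if "u \<in> ?X" for u
      using assms(5) that unfolding two_alternating_def has_triangle_def by blast
    ultimately have "?h t \<in> {\<zero>\<^bsub>W\<^esub>}"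
      by (intro tensor_lift_in_submodule[OF W assms(4) submodule_zero[OF W], of ?X]) blast+
    then show ?thesis by blast
  qed
  obtain f where f: "f \<in> extensional (carrier L.Q)" "f \<in> module_hom K L.Q W"
    "\<And>x. x \<in> carrier ?T \<Longrightarrow> f (?E +>\<^bsub>?T\<^esub> x) = ?h x"
    using L.hom_factors[OF W h ker] by metis
  have "f (alpha K V n v) = \<phi> v" if "v \<in> families V (upper_pairs n)" for v
    unfolding alpha f(3)[OF simple[OF that]] by (rule tensor_lift_simple[OF W assms(4) that])
  note f = f this
  show ?thesis
    unfolding L linear_iff
  proof (rule ex1I[of _ f])
    show "f \<in> extensional (carrier L.Q) \<and> f \<in> module_hom K L.Q W \<and>
        (\<forall>v\<in>families V (upper_pairs n). f (alpha K V n v) = \<phi> v)"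
      using f(1,2,4) by blast
  next
    fix g
    assume "g \<in> extensional (carrier L.Q) \<and> g \<in> module_hom K L.Q W \<and>
        (\<forall>v\<in>families V (upper_pairs n). g (alpha K V n v) = \<phi> v)"
    then have g: "g \<in> extensional (carrier L.Q)" "g \<in> module_hom K L.Q W"
      "\<forall>v\<in>families V (upper_pairs n). g (alpha K V n v) = \<phi> v"
      by blast+
    have hom: "(\<lambda>x. g (?E +>\<^bsub>?T\<^esub> x)) \<in> module_hom K ?T W"
      by (rule module_hom_comp[OF L.coset_hom g(2)])
    \<comment> \<open>Composed with the coset map, \<open>g\<close> is a homomorphism on the tensor
      power that agrees with \<open>?h\<close> on simple tensors, and these span.\<close>
    have eq: "g (?E +>\<^bsub>?T\<^esub> x) = ?h x" if "x \<in> carrier ?T" for x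
    proof (rule hom_eq_on_simple_tensors[OF W hom[unfolded T] h[unfolded T], folded T, OF _ that])
      fix v assume v: "v \<in> families V (upper_pairs n)"
      show "g (?E +>\<^bsub>?T\<^esub> simple_tensor K V (upper_pairs n) v) = ?h (simple_tensor K V (upper_pairs n) v)"
        unfolding tensor_lift_simple[OF W assms(4) v] using g(3) v unfolding alpha by blast
    qed
    show "g = f"
    proof (rule extensionalityI[OF g(1) f(1)])
      fix C assume "C \<in> carrier L.Q"
      then show "g C = f C"
      proof (rule L.quot_cases)
        fix x assume "x \<in> carrier ?T" "C = ?E +>\<^bsub>?T\<^esub> x"
        then show ?thesis
          using eq f(3) by metis
      qed
    qed
  qed
qed

end
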